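(* Let $n\ge1$ and let $\Gamma_n$, $d$, $\Lambda_n$ and the labeling $p\mapsto\sigma_p$ be as follows: $\Gamma_n$ is the Cayley graph of $S_n$ generated by all transpositions with graph metric $d$; $\Lambda_n$ is the set of permutations $\sigma_p$ where $p$ ranges over noncrossing partitions of $\{1,\dots,n\}$ and $\sigma_p$ has as cycles the blocks of $p$, each written in increasing order; and $d_\Lambda(\sigma,\tau)$ is the length of a shortest path from $\sigma$ to $\tau$ in the Hasse diagram of the refinement order on noncrossing partitions (equivalently, a shortest path in $\Gamma_n$ all of whose vertices lie in $\Lambda_n$). For $\sigma,\tau\in\Lambda_n$, place $2n$ points on a horizontal line in the order $L_1,R_1,L_2,R_2,\dots,L_n,R_n$; in the upper half-plane draw pairwise disjoint arcs joining $R_i$ to $L_{\sigma(i)}$ for each $i$, and in the lower half-plane draw pairwise disjoint arcs joining $R_i$ to $L_{\tau(i)}$ for each $i$ (this is possible since $\sigma,\tau\in\Lambda_n$). The union is a disjoint collection of simple closed curves (a system of meanders); let $\Pi_0(\sigma,\tau)$ be the number of its connected components. Then for any $\sigma,\tau\in\Lambda_n$ and any integer $k$, the following are equivalent: (1) $\Pi_0(\sigma,\tau)=k$; (2) $d(\sigma,\tau)=n-k$; (3) $d_\Lambda(\sigma,\tau)=n-k$. In particular, $(\sigma,\tau)$ determines a meander (a single closed curve) if and only if $d(\sigma,\tau)=d_\Lambda(\sigma,\tau)=n-1$.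
   Context: A partition of $\{1,\dots,n\}$ is noncrossing if whenever $i<j<k<\ell$ with $i\sim k$ and $j\sim\ell$, all four lie in one block. The refinement order: $p\preceq q$ if each block of $p$ lies in a block of $q$; the Hasse diagram joins $p,q$ when one covers the other (differs by splitting one block into two). Permutations act on the left (composition right-to-left). The points $L_i,R_i$ are the $2n$ transverse intersection points of the curves with the horizontal line. *)

theory Defs
  imports "HOL-Analysis.Analysis" "HOL-Combinatorics.Combinatorics"
begin

definition noncrossing :: "nat set set \<Rightarrow> bool" where
  "noncrossing p \<longleftrightarrow>
     (\<forall>i j k l. i < j \<and> j < k \<and> k < l \<and>
        (\<exists>B\<in>p. i \<in> B \<and> k \<in> B) \<and> (\<exists>C\<in>p. j \<in> C \<and> l \<in> C) \<longrightarrow>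
        (\<exists>D\<in>p. {i, j, k, l} \<subseteq> D))"

definition NC :: "nat \<Rightarrow> nat set set set" where
  "NC n = {p. partition_on {1..n} p \<and> noncrossing p}"

text \<open>The union below is the block of \<^term>\<open>p\<close> containing \<^term>\<open>i\<close>, or empty
  (whence \<^term>\<open>i\<close> is fixed) if there is none.  \<^const>\<open>cycle_of_list\<close> sends
  each list entry to its successor and the last entry to the first.\<close>

definition sigma :: "nat set set \<Rightarrow> nat \<Rightarrow> nat" where
  "sigma p i = cycle_of_list (sorted_list_of_set (\<Union>{B\<in>p. i \<in> B})) i"

definition Lambda :: "nat \<Rightarrow> (nat \<Rightarrow> nat) set" where
  "Lambda n = sigma ` NC n"

text \<open>Length of a shortest path in the graph with symmetric edge relation \<^term>\<open>E\<close>.  This is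
  only meaningful for vertices in the same connected component; the graphs below are
  connected (on the vertex sets of all permutations, respectively \<^const>\<open>Lambda\<close>).\<close>

definition graph_dist :: "('a \<times> 'a) set \<Rightarrow> 'a \<Rightarrow> 'a \<Rightarrow> nat" where
  "graph_dist E x y = (LEAST m. (x, y) \<in> E ^^ m)"

definition cayley_edges :: "nat \<Rightarrow> ((nat \<Rightarrow> nat) \<times> (nat \<Rightarrow> nat)) set" where
  "cayley_edges n =
     {(\<sigma>, \<sigma> \<circ> Transposition.transpose a b) | \<sigma> a b.
        \<sigma> permutes {1..n} \<and> a \<in> {1..n} \<and> b \<in> {1..n} \<and> a \<noteq> b}"

definition cayley_dist :: "nat \<Rightarrow> (nat \<Rightarrow> nat) \<Rightarrow> (nat \<Rightarrow> nat) \<Rightarrow> nat" where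
  "cayley_dist n = graph_dist (cayley_edges n)"

definition NC_less :: "nat \<Rightarrow> nat set set \<Rightarrow> nat set set \<Rightarrow> bool" where
  "NC_less n p q \<longleftrightarrow> p \<in> NC n \<and> q \<in> NC n \<and> refines {1..n} p q \<and> p \<noteq> q"

definition NC_covered :: "nat \<Rightarrow> nat set set \<Rightarrow> nat set set \<Rightarrow> bool" where
  "NC_covered n p q \<longleftrightarrow> NC_less n p q \<and> (\<nexists>r. NC_less n p r \<and> NC_less n r q)"

text \<open>The Hasse diagram, with each vertex \<^term>\<open>p\<close> labeled by \<^term>\<open>sigma p\<close>.\<close>

definition hasse_edges :: "nat \<Rightarrow> ((nat \<Rightarrow> nat) \<times> (nat \<Rightarrow> nat)) set" where
  "hasse_edges n = {(sigma p, sigma q) | p q. NC_covered n p q \<or> NC_covered n q p}"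

definition Lambda_dist :: "nat \<Rightarrow> (nat \<Rightarrow> nat) \<Rightarrow> (nat \<Rightarrow> nat) \<Rightarrow> nat" where
  "Lambda_dist n = graph_dist (hasse_edges n)"

text \<open>The horizontal line is the real axis of the complex plane; the points occur on it in the
  order \<open>L 1, R 1, L 2, R 2, \<dots>, L n, R n\<close>.\<close>

definition meander_points :: "nat \<Rightarrow> (nat \<Rightarrow> real) \<Rightarrow> (nat \<Rightarrow> real) \<Rightarrow> bool" where
  "meander_points n L R \<longleftrightarrow>
     (\<forall>i\<in>{1..n}. L i < R i) \<and> (\<forall>i\<in>{1..<n}. R i < L (Suc i))"

definition arc_family ::
  "nat \<Rightarrow> (nat \<Rightarrow> real) \<Rightarrow> (nat \<Rightarrow> real) \<Rightarrow> complex set \<Rightarrow> (nat \<Rightarrow> nat) \<Rightarrow>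
    (nat \<Rightarrow> real \<Rightarrow> complex) \<Rightarrow> bool" where
  "arc_family n L R H \<sigma> g \<longleftrightarrow>
     (\<forall>i\<in>{1..n}. arc (g i) \<and>
        pathstart (g i) = complex_of_real (R i) \<and>
        pathfinish (g i) = complex_of_real (L (\<sigma> i)) \<and>
        path_image (g i) - {pathstart (g i), pathfinish (g i)} \<subseteq> H) \<and>
     disjoint_family_on (\<lambda>i. path_image (g i)) {1..n}"

definition meander_drawing ::
  "nat \<Rightarrow> (nat \<Rightarrow> real) \<Rightarrow> (nat \<Rightarrow> real) \<Rightarrow> (nat \<Rightarrow> nat) \<Rightarrow> (nat \<Rightarrow> nat) \<Rightarrow>
    (nat \<Rightarrow> real \<Rightarrow> complex) \<Rightarrow> (nat \<Rightarrow> real \<Rightarrow> complex) \<Rightarrow> bool" where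
  "meander_drawing n L R \<sigma> \<tau> u l \<longleftrightarrow>
     arc_family n L R {z. Im z > 0} \<sigma> u \<and> arc_family n L R {z. Im z < 0} \<tau> l"

definition meander_system ::
  "nat \<Rightarrow> (nat \<Rightarrow> real \<Rightarrow> complex) \<Rightarrow> (nat \<Rightarrow> real \<Rightarrow> complex) \<Rightarrow> complex set" where
  "meander_system n u l = (\<Union>i\<in>{1..n}. path_image (u i) \<union> path_image (l i))"

definition simple_closed_curve :: "complex set \<Rightarrow> bool" where
  "simple_closed_curve C \<longleftrightarrow>
     (\<exists>g. simple_path g \<and> pathfinish g = pathstart g \<and> path_image g = C)"

end

theory Submission
  imports Defs
begin

text \<open>
  All the distances equal \<open>n - c\<close>, where \<open>c\<close> is the number of cycles of
  \<open>\<sigma>\<inverse> \<circ> \<tau>\<close>.  A transposition changes the number of cycles by at most one, which gives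
  the lower bound already in the Cayley graph.  For the upper bound, \<open>\<Lambda>\<close> is viewed as the
  set of those permutations \<open>\<sigma>\<close> whose arcs \<open>R i -- L (\<sigma> i)\<close> do not cross.  The shortest arc
  \<open>R i -- L (\<sigma> i)\<close> of \<open>\<sigma>\<close> that is not an arc of \<open>\<tau>\<close> is not crossed by any arc of \<open>\<tau>\<close>, since
  \<open>\<sigma>\<close> and \<open>\<tau>\<close> agree on the points it encloses.  Hence the arcs \<open>R i -- L (\<tau> i)\<close> and
  \<open>R k -- L (\<tau> k)\<close> of \<open>\<tau>\<close>, where \<open>\<tau> k = \<sigma> i\<close>, may be exchanged for \<open>R i -- L (\<sigma> i)\<close> and
  \<open>R k -- L (\<tau> i)\<close> without creating a crossing.  This composes \<open>\<tau>\<close> with a transposition and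
  splits off the fixed point \<open>i\<close> from a cycle of \<open>\<sigma>\<inverse> \<circ> \<tau>\<close>.

  A transposition merges two cycles or cuts one, so that it is a covering relation if it connects
  two elements of \<open>\<Lambda>\<close>; the same exchange shows that all covering relations arise in this way.
  Finally, following a curve of the drawing from \<open>R i\<close> through the lower and then the upper half-plane
  leads to \<open>R (\<sigma>\<inverse> (\<tau> i))\<close>, so that the curves correspond to the cycles of
  \<open>\<sigma>\<inverse> \<circ> \<tau>\<close>.
\<close>

subsection \<open>Merging two blocks of a partition\<close>

lemma partition_on_block_unique:
  assumes "partition_on S p" "B \<in> p" "C \<in> p" "x \<in> B" "x \<in> C"
  shows "B = C"
  using assms by (auto simp: partition_on_def disjoint_def)

lemma partition_on_obtain_block:
  assumes "partition_on S p" "x \<in> S"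
  obtains B where "B \<in> p" "x \<in> B"
  using assms by (auto simp: partition_on_def)

lemma partition_on_block_subset: "partition_on S p \<Longrightarrow> B \<in> p \<Longrightarrow> B \<subseteq> S"
  by (auto simp: partition_on_def)

lemma partition_on_subset_eq:
  assumes p: "partition_on S p" and q: "partition_on S q" and "p \<subseteq> q"
  shows "p = q"
proof
  show "q \<subseteq> p"
  proof
    fix X assume X: "X \<in> q"
    then obtain x where x: "x \<in> X" using partition_onD3[OF q] by (cases "X = {}") auto
    then have "x \<in> S" using partition_on_block_subset[OF q X] by blast
    then obtain B where B: "B \<in> p" "x \<in> B" using partition_on_obtain_block[OF p] by blast
    then have "B = X" using partition_on_block_unique[OF q _ X _ x] \<open>p \<subseteq> q\<close> by blast
    then show "X \<in> p" using B by simp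
  qed
qed fact

definition merge_blocks :: "'a set \<Rightarrow> 'a set \<Rightarrow> 'a set set \<Rightarrow> 'a set set" where
  "merge_blocks A B p = insert (A \<union> B) (p - {A, B})"

lemma partition_on_merge_blocks:
  assumes p: "partition_on S p" and AB: "A \<in> p" "B \<in> p"
  shows "partition_on S (merge_blocks A B p)"
proof -
  have disj: "disjnt X Y" if "X \<in> p" "Y \<in> p" "X \<noteq> Y" for X Y
    using pairwiseD[OF partition_onD2[OF p] that] .
  have "partition_on (S - (A \<union> B)) (p - {A, B})"
    using p AB disj by (auto simp: partition_on_def pairwise_def disjnt_iff)
  moreover have "disjnt (A \<union> B) (\<Union>(p - {A, B}))"
    using AB disj by (auto simp: disjnt_Un1)
  moreover have "A \<union> B \<subseteq> S" "A \<union> B \<noteq> {}"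
    using p AB by (auto simp: partition_on_def)
  ultimately show ?thesis
    by (simp add: merge_blocks_def partition_on_insert)
qed

lemma Un_blocks_notin:
  assumes "partition_on S p" "A \<in> p" "B \<in> p" "A \<noteq> B"
  shows "A \<union> B \<notin> p"
proof
  assume "A \<union> B \<in> p"
  moreover have "A \<noteq> {}" "B \<noteq> {}" using assms partition_onD3 by blast+
  ultimately have "A \<union> B = A" "A \<union> B = B"
    using partition_on_block_unique[OF assms(1)] assms(2,3) by blast+
  then show False using \<open>A \<noteq> B\<close> by blast
qed

lemma card_merge_blocks:
  assumes "partition_on S p" "finite p" "A \<in> p" "B \<in> p" "A \<noteq> B"
  shows "Suc (card (merge_blocks A B p)) = card p"
proof -
  have "card (merge_blocks A B p) = Suc (card (p - {A, B}))"
    using Un_blocks_notin[OF assms(1,3-5)] assms(2) by (simp add: merge_blocks_def)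
  also have "card (p - {A, B}) = card p - 2"
    using assms by (subst card_Diff_subset) auto
  finally show ?thesis
    using card_mono[of p "{A, B}"] assms by auto
qed

lemma refines_merge_blocks:
  assumes "partition_on S p" "A \<in> p" "B \<in> p"
  shows "refines S p (merge_blocks A B p)"
  using assms partition_on_merge_blocks[OF assms] by (auto simp: refines_def merge_blocks_def)

lemma merge_blocks_refines:
  assumes "refines S p q" "A \<in> p" "B \<in> p" "Y \<in> q" "A \<union> B \<subseteq> Y"
  shows "refines S (merge_blocks A B p) q"
  using assms partition_on_merge_blocks[of S p A B] by (auto simp: refines_def merge_blocks_def)

lemma refines_intermediate_block:
  assumes pr: "refines S p r" and rq: "refines S r q" and X: "X \<in> p" "X \<subseteq> Z" and Z: "Z \<in> q"
  obtains Y where "Y \<in> r" "X \<subseteq> Y" "Y \<subseteq> Z"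
proof -
  have p: "partition_on S p" and q: "partition_on S q" using pr rq by (auto simp: refines_def)
  obtain Y where Y: "Y \<in> r" "X \<subseteq> Y" using pr X(1) by (auto simp: refines_def)
  obtain Z' where Z': "Z' \<in> q" "Y \<subseteq> Z'" using rq Y(1) by (auto simp: refines_def)
  have "X \<noteq> {}" using X(1) partition_onD3[OF p] by blast
  then have "Z' = Z" using partition_on_block_unique[OF q Z'(1) Z] X(2) Y(2) Z'(2) by blast
  then show thesis using that[OF Y] Z'(2) by simp
qed

lemma refines_merge_blocks_cases:
  assumes pr: "refines S p r" and rq: "refines S r (merge_blocks A B p)" and AB: "A \<in> p" "B \<in> p"
  shows "r = p \<or> r = merge_blocks A B p"
proof -
  have p: "partition_on S p" and r: "partition_on S r" and q: "partition_on S (merge_blocks A B p)"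
    using pr rq by (auto simp: refines_def)
  have Un_in: "A \<union> B \<in> merge_blocks A B p" by (simp add: merge_blocks_def)
  have common: "X \<in> r" if X: "X \<in> p - {A, B}" for X
    using refines_intermediate_block[OF pr rq, of X X] X by (auto simp: merge_blocks_def)
  obtain Y where Y: "Y \<in> r" "A \<subseteq> Y" "Y \<subseteq> A \<union> B"
    using refines_intermediate_block[OF pr rq AB(1) Un_upper1 Un_in] .
  obtain Z where Z: "Z \<in> r" "B \<subseteq> Z" "Z \<subseteq> A \<union> B"
    using refines_intermediate_block[OF pr rq AB(2) Un_upper2 Un_in] .
  show ?thesis
  proof (cases "Y = Z")
    case True
    then have "A \<union> B \<in> r" using Y Z by (metis Un_least subset_antisym)
    then show ?thesis
      using partition_on_subset_eq[OF q r] common by (auto simp: merge_blocks_def)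
  next
    case False
    then have "Y \<inter> Z = {}" using partition_on_block_unique[OF r Y(1) Z(1)] by blast
    then have "Y = A" "Z = B" using Y Z by blast+
    then have "A \<in> r" "B \<in> r" using Y Z by blast+
    then show ?thesis
      using partition_on_subset_eq[OF p r] common by blast
  qed
qed

subsection \<open>Orbits and transpositions\<close>

abbreviation transposition :: "'a \<Rightarrow> 'a \<Rightarrow> 'a \<Rightarrow> 'a" where
  "transposition \<equiv> Transposition.transpose"

definition orbits :: "'a set \<Rightarrow> ('a \<Rightarrow> 'a) \<Rightarrow> 'a set set" where
  "orbits S f = orbit f ` S"

lemma orbit_closed_subset:
  assumes "\<And>y. y \<in> A \<Longrightarrow> f y \<in> A" "x \<in> A"
  shows "orbit f x \<subseteq> A"
proof
  fix y assume "y \<in> orbit f x"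
  then show "y \<in> A" by induction (use assms in auto)
qed

lemma orbit_eq_if_mem:
  assumes "permutation f" "y \<in> orbit f x"
  shows "orbit f y = orbit f x"
  using orbit_cyclic_eq3[OF cyclic_on_orbit'[OF assms(1)] assms(2)] .

lemma orbit_eq_iff_mem:
  assumes "permutation f"
  shows "orbit f y = orbit f x \<longleftrightarrow> y \<in> orbit f x"
  using orbit_eq_if_mem[OF assms] permutation_self_in_orbit[OF assms, of y] by blast

lemma partition_on_orbits:
  assumes f: "f permutes S" and S: "finite S"
  shows "partition_on S (orbits S f)"
proof (rule partition_onI)
  note perm = permutes_imp_permutation[OF S f]
  show "\<Union>(orbits S f) = S"
    using permutes_orbit_subset[OF f] permutation_self_in_orbit[OF perm] by (fastforce simp: orbits_def)
  show "{} \<notin> orbits S f"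
    using orbit_nonempty[of f] by (auto simp: orbits_def)
  show "disjnt A B" if "A \<in> orbits S f" "B \<in> orbits S f" "A \<noteq> B" for A B
    using that orbit_eq_if_mem[OF perm] unfolding orbits_def disjnt_iff by (metis imageE)
qed

lemma orbit_enumerate:
  assumes "permutation f"
  obtains m where "0 < m" "(f ^^ m) x = x" "inj_on (\<lambda>k. (f ^^ k) x) {..<m}"
    "orbit f x = (\<lambda>k. (f ^^ k) x) ` {..<m}"
proof -
  have x: "x \<in> orbit f x" using assms by (rule permutation_self_in_orbit)
  show thesis
    using that[of "funpow_dist1 f x x"] funpow_dist1_prop[OF x] inj_on_funpow_dist1[OF x]
      orbit_conv_funpow_dist1[OF x] by (simp add: atLeast0LessThan del: funpow.simps)
qed

lemma permutation_comp_transposition: "permutation f \<Longrightarrow> permutation (f \<circ> transposition a b)"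
  by (intro permutation_compose permutation_swap_id)

lemma comp_transposition_twice: "f \<circ> transposition a b \<circ> transposition a b = f"
  by (simp add: comp_assoc)

lemma permutes_comp_transposition: "f permutes S \<Longrightarrow> a \<in> S \<Longrightarrow> b \<in> S \<Longrightarrow> f \<circ> transposition a b permutes S"
  by (intro permutes_compose permutes_swap_id)

lemma orbit_comp_transposition_other:
  assumes f: "permutation f" and "a \<notin> orbit f x" "b \<notin> orbit f x"
  shows "orbit (f \<circ> transposition a b) x = orbit f x"
proof (rule orbit_cong)
  show "x \<in> orbit f x" using f by (rule permutation_self_in_orbit)
  show "(f \<circ> transposition a b) y = f y" if "y \<in> orbit f x" for y
    using assms that by (auto simp: Transposition.transpose_def)
qed

lemma orbit_comp_transposition_merge:
  assumes f: "permutation f" and b: "b \<notin> orbit f a"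
  shows "orbit (f \<circ> transposition a b) a = orbit f a \<union> orbit f b"
proof
  define g where "g = f \<circ> transposition a b"
  have g: "permutation g" unfolding g_def using f by (rule permutation_comp_transposition)
  have a: "a \<notin> orbit f b" using b orbit_eq_iff_mem[OF f] by metis
  have into: "orbit f x \<subseteq> orbit g y" if xy: "f x = g y" "y \<notin> orbit f x" "{x, y} = {a, b}" for x y
  proof
    fix z assume "z \<in> orbit f x"
    then show "z \<in> orbit g y"
    proof induction
      case base
      then show ?case using orbit.base[of g y] xy(1) by simp
    next
      case (step z)
      have "z \<noteq> y" using step.hyps xy(2) by blast
      then have "f z = g z \<or> f z = g y" using xy by (cases "z = x") (auto simp: g_def doubleton_eq_iff)
      then show ?case using step.IH by (auto intro: orbit.intros)
    qed
  qed
  have "orbit f b \<subseteq> orbit g a" using into[of b a] a by (simp add: g_def insert_commute)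
  moreover have "orbit f a \<subseteq> orbit g b" using into[of a b] b by (simp add: g_def)
  ultimately show "orbit f a \<union> orbit f b \<subseteq> orbit g a"
    using permutation_self_in_orbit[OF f, of a] orbit_eq_if_mem[OF g, of a b] by auto
  show "orbit g a \<subseteq> orbit f a \<union> orbit f b"
    using permutation_self_in_orbit[OF f]
    by (intro orbit_closed_subset) (auto simp: g_def Transposition.transpose_def intro: orbit.intros)
qed

lemma orbits_comp_transposition_merge:
  assumes f: "f permutes S" "finite S" and ab: "a \<in> S" "b \<in> S" "orbit f a \<noteq> orbit f b"
  shows "orbits S (f \<circ> transposition a b) = merge_blocks (orbit f a) (orbit f b) (orbits S f)"
proof (rule partition_on_subset_eq[symmetric])
  note perm = permutes_imp_permutation[OF f(2,1)]
  show "partition_on S (orbits S (f \<circ> transposition a b))"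
    using partition_on_orbits[OF permutes_comp_transposition[OF f(1) ab(1,2)] f(2)] .
  show "partition_on S (merge_blocks (orbit f a) (orbit f b) (orbits S f))"
    using ab by (intro partition_on_merge_blocks partition_on_orbits f) (auto simp: orbits_def)
  have "orbit f a \<union> orbit f b \<in> orbits S (f \<circ> transposition a b)"
    using orbit_comp_transposition_merge[OF perm] orbit_eq_if_mem[OF perm] ab
    by (metis image_eqI orbits_def)
  moreover have "orbit f x \<in> orbits S (f \<circ> transposition a b)"
    if "x \<in> S" "orbit f x \<noteq> orbit f a" "orbit f x \<noteq> orbit f b" for x
    using orbit_comp_transposition_other[OF perm] orbit_eq_if_mem[OF perm] that
    by (metis image_eqI orbits_def)
  ultimately show "merge_blocks (orbit f a) (orbit f b) (orbits S f) \<subseteq> orbits S (f \<circ> transposition a b)"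
    by (auto simp: merge_blocks_def orbits_def)
qed

lemma orbit_comp_transposition_subset:
  assumes f: "permutation f" and ab: "orbit f a = orbit f b"
  shows "orbit (f \<circ> transposition a b) x \<subseteq> orbit f x"
proof (rule orbit_closed_subset)
  show "x \<in> orbit f x" using f by (rule permutation_self_in_orbit)
  have "a \<in> orbit f x \<longleftrightarrow> b \<in> orbit f x" using ab orbit_eq_iff_mem[OF f] by metis
  then show "(f \<circ> transposition a b) y \<in> orbit f x" if "y \<in> orbit f x" for y
    using that by (auto simp: Transposition.transpose_def intro: orbit.step)
qed

lemma orbits_comp_transposition_same:
  assumes f: "permutation f" and "orbit f a = orbit f b"
    and "orbit (f \<circ> transposition a b) a = orbit (f \<circ> transposition a b) b"
  shows "orbits S (f \<circ> transposition a b) = orbits S f"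
proof -
  have "orbit (f \<circ> transposition a b) x = orbit f x" for x
    using orbit_comp_transposition_subset[OF f assms(2)]
      orbit_comp_transposition_subset[OF permutation_comp_transposition[OF f] assms(3)]
    unfolding comp_transposition_twice by (rule subset_antisym)
  then show ?thesis by (simp add: orbits_def)
qed

lemma card_orbits_comp_transposition_merge:
  assumes "f permutes S" "finite S" "a \<in> S" "b \<in> S" "orbit f a \<noteq> orbit f b"
  shows "Suc (card (orbits S (f \<circ> transposition a b))) = card (orbits S f)"
  unfolding orbits_comp_transposition_merge[OF assms]
  using assms by (intro card_merge_blocks[OF partition_on_orbits]) (auto simp: orbits_def)

lemma card_orbits_comp_transposition_le:
  assumes f: "f permutes S" "finite S" and ab: "a \<in> S" "b \<in> S"
  shows "card (orbits S f) \<le> Suc (card (orbits S (f \<circ> transposition a b)))"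
proof -
  have g: "f \<circ> transposition a b permutes S" using permutes_comp_transposition[OF f(1) ab(1,2)] .
  consider (merged) "orbit f a \<noteq> orbit f b"
    | (cut) "orbit (f \<circ> transposition a b) a \<noteq> orbit (f \<circ> transposition a b) b"
    | (same) "orbits S (f \<circ> transposition a b) = orbits S f"
    using orbits_comp_transposition_same[OF permutes_imp_permutation[OF f(2,1)], of a b S] by argo
  then show ?thesis
  proof cases
    case merged
    then show ?thesis using card_orbits_comp_transposition_merge[OF f ab] by simp
  next
    case cut
    then show ?thesis
      using card_orbits_comp_transposition_merge[OF g f(2) ab] by (simp add: comp_transposition_twice)
  qed simp
qed

lemma card_orbits_comp_transposition_fix:
  assumes f: "f permutes S" "finite S" and ab: "a \<in> S" "b \<in> S" and b: "f b = a" and ne: "a \<noteq> b"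
  shows "card (orbits S (f \<circ> transposition a b)) = Suc (card (orbits S f))"
proof -
  define g where "g = f \<circ> transposition a b"
  have g: "g permutes S" unfolding g_def using f(1) ab by (rule permutes_comp_transposition)
  have "orbit g a = {a}" using b by (simp add: orbit_eq_singleton_iff g_def)
  moreover have "b \<in> orbit g b"
    using permutation_self_in_orbit[OF permutes_imp_permutation[OF f(2) g]] .
  ultimately have "orbit g a \<noteq> orbit g b" using ne by auto
  then show ?thesis
    using card_orbits_comp_transposition_merge[OF g f(2) ab] by (simp add: g_def comp_transposition_twice)
qed

subsection \<open>The number of relative cycles of two permutations\<close>

definition num_rel_cycles :: "'a set \<Rightarrow> ('a \<Rightarrow> 'a) \<Rightarrow> ('a \<Rightarrow> 'a) \<Rightarrow> nat" where
  "num_rel_cycles S \<sigma> \<tau> = card (orbits S (inv \<sigma> \<circ> \<tau>))"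

lemma permutes_inv_comp: "\<sigma> permutes S \<Longrightarrow> \<tau> permutes S \<Longrightarrow> inv \<sigma> \<circ> \<tau> permutes S"
  by (intro permutes_compose permutes_inv)

lemma num_rel_cycles_le_card: "finite S \<Longrightarrow> num_rel_cycles S \<sigma> \<tau> \<le> card S"
  unfolding num_rel_cycles_def orbits_def by (rule card_image_le)

lemma num_rel_cycles_self:
  assumes "\<sigma> permutes S"
  shows "num_rel_cycles S \<sigma> \<sigma> = card S"
proof -
  have "orbits S id = (\<lambda>x. {x}) ` S"
    unfolding orbits_def by (intro image_cong refl) (simp add: orbit_eq_singleton_iff)
  then show ?thesis
    using permutes_inv_o(2)[OF assms] by (simp add: num_rel_cycles_def card_image)
qed

lemma num_rel_cycles_comp_transposition_le:
  assumes "finite S" "\<sigma> permutes S" "\<tau> permutes S" "a \<in> S" "b \<in> S"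
  shows "num_rel_cycles S \<sigma> \<tau> \<le> Suc (num_rel_cycles S \<sigma> (\<tau> \<circ> transposition a b))"
  using card_orbits_comp_transposition_le[OF permutes_inv_comp[OF assms(2,3)] assms(1,4,5)]
  by (simp add: num_rel_cycles_def comp_assoc)

lemma num_rel_cycles_comp_transposition_eq:
  assumes S: "finite S" and \<sigma>: "\<sigma> permutes S" and \<tau>: "\<tau> permutes S" and ab: "a \<in> S" "b \<in> S" "a \<noteq> b"
    and b: "\<tau> b = \<sigma> a"
  shows "num_rel_cycles S \<sigma> (\<tau> \<circ> transposition a b) = Suc (num_rel_cycles S \<sigma> \<tau>)"
proof -
  have "(inv \<sigma> \<circ> \<tau>) b = a" using b permutes_inverses(2)[OF \<sigma>] by simp
  then show ?thesis
    using card_orbits_comp_transposition_fix[OF permutes_inv_comp[OF \<sigma> \<tau>] S ab(1,2)] ab(3)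
    by (simp add: num_rel_cycles_def comp_assoc)
qed

subsection \<open>Cyclic successors in a block\<close>

definition cyclic_succ :: "'a::linorder set \<Rightarrow> 'a \<Rightarrow> 'a \<Rightarrow> bool" where
  "cyclic_succ B x y \<longleftrightarrow> x \<in> B \<and> y \<in> B \<and> (if x < y then B \<inter> {x<..<y} = {} else B \<subseteq> {y..x})"

lemma cyclic_succD:
  assumes "cyclic_succ B x y"
  shows "x \<in> B" "y \<in> B"
    and "z \<in> B \<Longrightarrow> x < y \<and> (z \<le> x \<or> y \<le> z) \<or> y \<le> z \<and> z \<le> x"
  using assms unfolding cyclic_succ_def by (auto split: if_splits simp: not_less[symmetric])

lemma cyclic_succ_unique:
  assumes "cyclic_succ B x y" "cyclic_succ B x z"
  shows "y = z"
  using cyclic_succD[OF assms(1)] cyclic_succD[OF assms(2)]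
  by (metis order.antisym order.strict_trans1 leD)

lemma cyclic_succ_inj:
  assumes "cyclic_succ B x z" "cyclic_succ B y z"
  shows "x = y"
  using cyclic_succD[OF assms(1)] cyclic_succD[OF assms(2)]
  by (metis order.antisym order.strict_trans1 leD)

lemma cyclic_succ_subset:
  assumes "cyclic_succ B x y" "A \<subseteq> B" "x \<in> A" "y \<in> A"
  shows "cyclic_succ A x y"
  using assms unfolding cyclic_succ_def by (auto split: if_splits)

lemma cyclic_succ_nth:
  assumes xs: "sorted_wrt (<) xs" and k: "k < length xs"
  shows "cyclic_succ (set xs) (xs ! k) (xs ! (Suc k mod length xs))"
proof -
  have le_iff: "xs ! a \<le> xs ! b \<longleftrightarrow> a \<le> b" if "a < length xs" "b < length xs" for a b
    using that xs strict_sorted_iff sorted_wrt_nth_less[OF xs] sorted_nth_mono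
    by (metis leD leI)
  have index: "\<exists>m<length xs. z = xs ! m" if "z \<in> set xs" for z
    using that by (metis in_set_conv_nth)
  show ?thesis
  proof (cases "Suc k < length xs")
    case True
    then have "set xs \<inter> {xs ! k<..<xs ! Suc k} = {}"
      using index le_iff k by (fastforce simp: not_le[symmetric])
    then show ?thesis
      using True k le_iff[of "Suc k" k] by (auto simp: cyclic_succ_def)
  next
    case False
    then have last: "Suc k = length xs" using k by simp
    then have "set xs \<subseteq> {xs ! 0..xs ! k}"
      using index le_iff k by fastforce
    moreover have "xs ! 0 \<in> set xs" "xs ! k \<in> set xs"
      using nth_mem[OF k] nth_mem[OF order.strict_trans1[OF le0 k]] by blast+
    moreover have "xs ! 0 \<le> xs ! k"
      using le_iff[OF order.strict_trans1[OF le0 k] k] by simp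
    ultimately show ?thesis
      using last by (simp add: cyclic_succ_def leD)
  qed
qed

lemma cycle_of_list_nth:
  assumes "distinct xs" "k < length xs"
  shows "cycle_of_list xs (xs ! k) = xs ! (Suc k mod length xs)"
proof -
  have "map (cycle_of_list xs) xs = rotate1 xs"
    using cyclic_rotation[OF assms(1), of 1] by simp
  then show ?thesis
    using assms(2) by (metis nth_map nth_rotate1)
qed

lemma cyclic_succ_cycle_of_list:
  assumes "finite B" "x \<in> B"
  shows "cyclic_succ B x (cycle_of_list (sorted_list_of_set B) x)"
proof -
  define xs where "xs = sorted_list_of_set B"
  have xs: "distinct xs" "sorted_wrt (<) xs" "set xs = B"
    using assms(1) by (simp_all add: xs_def)
  obtain k where "k < length xs" "x = xs ! k"
    using assms(2) xs(3) by (metis in_set_conv_nth)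
  then show ?thesis
    using cyclic_succ_nth[OF xs(2)] cycle_of_list_nth[OF xs(1)] xs(3) by (metis xs_def)
qed

lemma orbit_eq_if_cyclic_succ:
  assumes f: "permutation f" and "finite B" and succ: "\<And>y. y \<in> B \<Longrightarrow> cyclic_succ B y (f y)" and x: "x \<in> B"
  shows "orbit f x = B"
proof
  have sub: "orbit f y \<subseteq> B" if "y \<in> B" for y
    using cyclic_succD(2)[OF succ] that by (intro orbit_closed_subset)
  then show "orbit f x \<subseteq> B" using x .
  have Max: "Max B \<in> orbit f y" if y: "y \<in> B" for y
  proof -
    define m where "m = Max (orbit f y)"
    have fin: "finite (orbit f y)" using sub[OF y] \<open>finite B\<close> finite_subset by blast
    have m: "m \<in> orbit f y" unfolding m_def using fin orbit_nonempty by (rule Max_in)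
    then have "f m \<le> m" unfolding m_def by (intro Max_ge fin orbit.step)
    then have "z \<le> m" if "z \<in> B" for z
      using cyclic_succD(3)[OF succ[of m] that] m sub[OF y] by fastforce
    then have "Max B = m" using m sub[OF y] \<open>finite B\<close> by (intro Max_eqI) auto
    then show ?thesis using m by simp
  qed
  show "B \<subseteq> orbit f x"
    using Max[OF x] Max orbit_eq_if_mem[OF f] permutation_self_in_orbit[OF f] by blast
qed

subsection \<open>The permutation of a partition\<close>

lemma cyclic_succ_sigma:
  assumes "partition_on S p" "finite S" "B \<in> p" "x \<in> B"
  shows "cyclic_succ B x (sigma p x)"
proof -
  have "\<Union>{C\<in>p. x \<in> C} = B"
    using assms partition_on_block_unique[OF assms(1)] by blast
  then show ?thesis
    unfolding sigma_def
    using assms partition_on_block_subset finite_subset by (metis cyclic_succ_cycle_of_list)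
qed

lemma sigma_eqI:
  assumes "partition_on S p" "finite S" "B \<in> p" "cyclic_succ B x y"
  shows "sigma p x = y"
  using cyclic_succ_unique[OF cyclic_succ_sigma[OF assms(1-3) cyclic_succD(1)[OF assms(4)]] assms(4)] .

lemma sigma_in_block:
  assumes "partition_on S p" "finite S" "B \<in> p" "x \<in> B"
  shows "sigma p x \<in> B"
  using cyclic_succD(2)[OF cyclic_succ_sigma[OF assms]] .

lemma sigma_outside:
  assumes "partition_on S p" "x \<notin> S"
  shows "sigma p x = x"
proof -
  have "{B\<in>p. x \<in> B} = {}" using assms by (auto simp: partition_on_def)
  then show ?thesis by (simp only: sigma_def) simp
qed

lemma sigma_permutes:
  assumes p: "partition_on S p" and S: "finite S"
  shows "sigma p permutes S"
proof (rule bij_imp_permutes)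
  have "sigma p ` S \<subseteq> S"
    using partition_on_obtain_block[OF p] sigma_in_block[OF p S] partition_on_block_subset[OF p]
    by (metis image_subsetI subsetD)
  moreover have "inj_on (sigma p) S"
  proof (rule inj_onI)
    fix x y assume xy: "x \<in> S" "y \<in> S" "sigma p x = sigma p y"
    obtain B C where B: "B \<in> p" "x \<in> B" and C: "C \<in> p" "y \<in> C"
      using partition_on_obtain_block[OF p] xy by metis
    have "B = C"
      using sigma_in_block[OF p S B] sigma_in_block[OF p S C] xy
        partition_on_block_unique[OF p] B C by metis
    then show "x = y"
      using cyclic_succ_sigma[OF p S B] cyclic_succ_sigma[OF p S C] xy cyclic_succ_inj by metis
  qed
  ultimately show "bij_betw (sigma p) S S"
    using endo_inj_surj[OF S] by (simp add: bij_betw_def)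
qed (rule sigma_outside[OF p])

lemma orbit_sigma:
  assumes "partition_on S p" "finite S" "B \<in> p" "x \<in> B"
  shows "orbit (sigma p) x = B"
  using assms cyclic_succ_sigma[OF assms(1-3)] partition_on_block_subset[OF assms(1,3)] finite_subset
  by (intro orbit_eq_if_cyclic_succ permutes_imp_permutation[OF assms(2)] sigma_permutes) auto

lemma orbits_sigma:
  assumes p: "partition_on S p" and S: "finite S"
  shows "orbits S (sigma p) = p"
proof (rule partition_on_subset_eq)
  show "partition_on S (orbits S (sigma p))"
    using partition_on_orbits[OF sigma_permutes[OF p S] S] .
  show "orbits S (sigma p) \<subseteq> p"
    unfolding orbits_def using partition_on_obtain_block[OF p] orbit_sigma[OF p S]
    by (metis image_subsetI)
qed fact

subsection \<open>Planar permutations\<close>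

definition strictly_between :: "'a::linorder \<Rightarrow> 'a \<Rightarrow> 'a \<Rightarrow> bool" where
  "strictly_between a b x \<longleftrightarrow> a < x \<and> x < b \<or> b < x \<and> x < a"

lemma strictly_between_endpoint [simp]: "\<not> strictly_between a b a" "\<not> strictly_between a b b"
  by (auto simp: strictly_between_def)

lemma strictly_between_iff_neq:
  assumes "a \<noteq> x" "b \<noteq> x"
  shows "strictly_between a b x \<longleftrightarrow> (a < x \<longleftrightarrow> \<not> b < x)"
  using assms by (auto simp: strictly_between_def)

lemma strictly_between_eq_commute:
  assumes "a \<noteq> c" "a \<noteq> d" "b \<noteq> c" "b \<noteq> d"
  shows "(strictly_between a b c \<longleftrightarrow> strictly_between a b d) \<longleftrightarrow>
    (strictly_between c d a \<longleftrightarrow> strictly_between c d b)"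
proof -
  have "c < a \<longleftrightarrow> \<not> a < c" "d < a \<longleftrightarrow> \<not> a < d" "c < b \<longleftrightarrow> \<not> b < c" "d < b \<longleftrightarrow> \<not> b < d"
    using assms by auto
  then show ?thesis using assms by (auto simp: strictly_between_iff_neq)
qed

text \<open>The points \<open>L i\<close> and \<open>R i\<close> receive the coordinates \<open>2 * i\<close> and \<open>2 * i + 1\<close>.\<close>

definition encloses :: "(nat \<Rightarrow> nat) \<Rightarrow> nat \<Rightarrow> nat \<Rightarrow> bool" where
  "encloses \<sigma> i = strictly_between (2 * i + 1) (2 * \<sigma> i)"

definition arcs_noncrossing :: "(nat \<Rightarrow> nat) \<Rightarrow> nat \<Rightarrow> nat \<Rightarrow> bool" where
  "arcs_noncrossing \<sigma> i j \<longleftrightarrow> (encloses \<sigma> i (2 * j + 1) \<longleftrightarrow> encloses \<sigma> i (2 * \<sigma> j))"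

definition planar :: "(nat \<Rightarrow> nat) \<Rightarrow> bool" where
  "planar \<sigma> \<longleftrightarrow> (\<forall>i j. arcs_noncrossing \<sigma> i j)"

lemma planarD: "planar \<sigma> \<Longrightarrow> encloses \<sigma> i (2 * j + 1) \<longleftrightarrow> encloses \<sigma> i (2 * \<sigma> j)"
  by (simp add: planar_def arcs_noncrossing_def)

lemma odd_less_even_iff: "Suc (2 * x) < 2 * y \<longleftrightarrow> x < y"
  by linarith

lemma encloses_odd: "encloses \<sigma> i (2 * j + 1) \<longleftrightarrow> (if i < \<sigma> i then i < j \<and> j < \<sigma> i else \<sigma> i \<le> j \<and> j < i)"
  by (auto simp: encloses_def strictly_between_def less_Suc_eq_le odd_less_even_iff)

lemma encloses_even: "encloses \<sigma> i (2 * j) \<longleftrightarrow> (if i < \<sigma> i then i < j \<and> j < \<sigma> i else \<sigma> i < j \<and> j \<le> i)"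
  by (auto simp: encloses_def strictly_between_def less_Suc_eq_le odd_less_even_iff)

lemma arcs_noncrossing_refl: "arcs_noncrossing \<sigma> i i"
  by (simp add: arcs_noncrossing_def encloses_def)

lemma arcs_noncrossing_sym:
  assumes "inj \<sigma>" "arcs_noncrossing \<sigma> i j"
  shows "arcs_noncrossing \<sigma> j i"
proof (cases "i = j")
  case False
  then have "2 * i + 1 \<noteq> 2 * \<sigma> j" "2 * \<sigma> i \<noteq> 2 * j + 1" "2 * \<sigma> i \<noteq> 2 * \<sigma> j"
    using assms(1) by (presburger, presburger, auto dest: injD)
  then show ?thesis
    using assms(2) False strictly_between_eq_commute[of "2 * i + 1" "2 * j + 1" "2 * \<sigma> j" "2 * \<sigma> i"]
    unfolding arcs_noncrossing_def encloses_def by simp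
qed (simp add: arcs_noncrossing_refl)

subsection \<open>Exchanging arcs\<close>

lemma planar_comp_transposition:
  assumes \<tau>: "planar \<tau>" "inj \<tau>"
    and closed: "\<And>z. strictly_between (2 * i + 1) (2 * \<tau> k) (2 * z + 1) \<longleftrightarrow>
      strictly_between (2 * i + 1) (2 * \<tau> k) (2 * \<tau> z)"
  shows "planar (\<tau> \<circ> transposition i k)"
proof -
  define \<rho> where "\<rho> = \<tau> \<circ> transposition i k"
  have \<rho>: "\<rho> i = \<tau> k" "\<rho> k = \<tau> i" "\<And>x. x \<noteq> i \<Longrightarrow> x \<noteq> k \<Longrightarrow> \<rho> x = \<tau> x"
    by (simp_all add: \<rho>_def)
  have "inj \<rho>" unfolding \<rho>_def using \<tau>(2) by (intro inj_compose) simp_all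
  note sym = arcs_noncrossing_sym[OF \<open>inj \<rho>\<close>]
  have new_arc: "arcs_noncrossing \<rho> i y" for y
    using closed[of y] closed[of i] closed[of k] \<rho>
    by (cases "y = i"; cases "y = k") (simp_all add: arcs_noncrossing_def encloses_def)
  have old_arc: "arcs_noncrossing \<rho> x y" if x: "x \<noteq> i" "x \<noteq> k" for x y
  proof -
    have enc: "encloses \<rho> x = encloses \<tau> x" using \<rho>(3)[OF x] by (simp add: encloses_def)
    have "encloses \<tau> x (2 * i + 1) \<longleftrightarrow> encloses \<tau> x (2 * \<tau> k)"
      using sym[OF new_arc[of x]] by (simp add: arcs_noncrossing_def enc \<rho>)
    then show ?thesis
      using planarD[OF \<tau>(1), of x] \<rho>
      by (cases "y = i"; cases "y = k") (simp_all add: arcs_noncrossing_def enc)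
  qed
  have "arcs_noncrossing \<rho> k y" for y
    using sym[OF new_arc[of k]] sym[OF old_arc[of y k]] arcs_noncrossing_refl[of \<rho> k] by metis
  then show ?thesis
    using new_arc old_arc unfolding planar_def \<rho>_def by metis
qed

lemma planar_exchange:
  assumes \<sigma>: "planar \<sigma>" "bij \<sigma>" and \<tau>: "planar \<tau>" "bij \<tau>" and "\<sigma> \<noteq> \<tau>"
  obtains i k where "\<tau> k = \<sigma> i" "\<sigma> i \<noteq> \<tau> i" "planar (\<tau> \<circ> transposition i k)"
proof -
  define width where "width x = max (2 * x + 1) (2 * \<sigma> x) - min (2 * x + 1) (2 * \<sigma> x)" for x
  obtain i where i: "\<sigma> i \<noteq> \<tau> i" and least: "\<And>x. \<sigma> x \<noteq> \<tau> x \<Longrightarrow> width i \<le> width x"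
    using ex_has_least_nat[of "\<lambda>x. \<sigma> x \<noteq> \<tau> x" _ width] \<open>\<sigma> \<noteq> \<tau>\<close> by blast
  obtain k where k: "\<tau> k = \<sigma> i" using bij_pointE[OF \<tau>(2)] by metis
  have agree: "\<tau> z = \<sigma> z" if "encloses \<sigma> i (2 * z + 1)" for z
  proof -
    have "encloses \<sigma> i (2 * \<sigma> z)" using planarD[OF \<sigma>(1)] that by blast
    then have "width z < width i"
      using that unfolding width_def encloses_def strictly_between_def by linarith
    then show ?thesis using least[of z] by fastforce
  qed
  have "encloses \<sigma> i (2 * z + 1) \<longleftrightarrow> encloses \<sigma> i (2 * \<tau> z)" for z
  proof
    show "encloses \<sigma> i (2 * \<tau> z)" if "encloses \<sigma> i (2 * z + 1)"
      using agree[OF that] planarD[OF \<sigma>(1)] that by simp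
  next
    assume enc: "encloses \<sigma> i (2 * \<tau> z)"
    obtain w where w: "\<sigma> w = \<tau> z" using bij_pointE[OF \<sigma>(2)] by metis
    then have "encloses \<sigma> i (2 * w + 1)" using enc planarD[OF \<sigma>(1)] by metis
    then show "encloses \<sigma> i (2 * z + 1)"
      using agree w bij_is_inj[OF \<tau>(2)] by (metis injD)
  qed
  then have "planar (\<tau> \<circ> transposition i k)"
    using k by (intro planar_comp_transposition \<tau> bij_is_inj) (simp_all add: encloses_def)
  then show thesis using that k i by blast
qed

subsection \<open>Noncrossing partitions and planar permutations\<close>

lemma noncrossing_blocks_eq:
  assumes p: "partition_on S p" and nc: "noncrossing p" and BC: "B \<in> p" "C \<in> p"
    and mem: "i \<in> B" "k \<in> B" "j \<in> C" "l \<in> C" and "i < j" "j < k" "k < l"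
  shows "B = C"
proof -
  obtain D where D: "D \<in> p" "{i, j, k, l} \<subseteq> D"
    using nc assms(3-) unfolding noncrossing_def by blast
  have "B = D" "C = D"
    using partition_on_block_unique[OF p BC(1) D(1) mem(1)] D(2)
      partition_on_block_unique[OF p BC(2) D(1) mem(3)] by auto
  then show ?thesis by simp
qed

lemma noncrossing_between:
  assumes p: "partition_on S p" and nc: "noncrossing p" and BC: "B \<in> p" "C \<in> p" "B \<noteq> C"
    and mem: "x \<in> B" "y \<in> B" "c \<in> C" "d \<in> C" and less: "x < c" "c < y"
  shows "x < d \<and> d < y"
proof -
  have "d \<noteq> x" "d \<noteq> y"
    using partition_on_block_unique[OF p BC(1,2)] BC(3) mem by auto
  moreover have "\<not> d < x"
    using noncrossing_blocks_eq[OF p nc BC(2,1) mem(4,3,1,2)] less BC(3) by auto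
  moreover have "\<not> y < d"
    using noncrossing_blocks_eq[OF p nc BC(1,2) mem] less BC(3) by auto
  ultimately show ?thesis by simp
qed

lemma sigma_notin_block:
  assumes p: "partition_on S p" and S: "finite S" and "B \<in> p" "j \<notin> B"
  shows "sigma p j \<notin> B"
proof (cases "j \<in> S")
  case True
  then obtain C where "C \<in> p" "j \<in> C" using partition_on_obtain_block[OF p] by blast
  then show ?thesis
    using sigma_in_block[OF p S] partition_on_block_unique[OF p] assms(3,4) by blast
qed (use sigma_outside[OF p] assms(4) in simp)

lemma sigma_between_iff:
  assumes p: "partition_on S p" and S: "finite S" and nc: "noncrossing p"
    and B: "B \<in> p" "x \<in> B" "y \<in> B" and j: "j \<notin> B"
  shows "x < sigma p j \<and> sigma p j < y \<longleftrightarrow> x < j \<and> j < y"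
proof (cases "j \<in> S")
  case True
  then obtain C where C: "C \<in> p" "j \<in> C" using partition_on_obtain_block[OF p] by blast
  have "B \<noteq> C" using C(2) j by blast
  then show ?thesis
    using noncrossing_between[OF p nc B(1) C(1) _ B(2,3)] C(2) sigma_in_block[OF p S C] by blast
qed (use sigma_outside[OF p] in simp)

lemma planar_sigma:
  assumes p: "partition_on S p" and S: "finite S" and nc: "noncrossing p"
  shows "planar (sigma p)"
proof -
  define \<sigma> where "\<sigma> = sigma p"
  have "encloses \<sigma> i (2 * j + 1) \<longleftrightarrow> encloses \<sigma> i (2 * \<sigma> j)" for i j
  proof (cases "i \<in> S")
    case False
    then have "\<sigma> i = i" unfolding \<sigma>_def by (rule sigma_outside[OF p])
    then show ?thesis by (auto simp: encloses_def strictly_between_def)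
  next
    case True
    then obtain B where B: "B \<in> p" "i \<in> B" using partition_on_obtain_block[OF p] by blast
    then have succ: "cyclic_succ B i (\<sigma> i)" unfolding \<sigma>_def by (rule cyclic_succ_sigma[OF p S])
    show ?thesis
    proof (cases "j \<in> B")
      case True
      have "\<sigma> j \<in> B" unfolding \<sigma>_def using sigma_in_block[OF p S B(1) True] .
      moreover have "\<sigma> i = \<sigma> j \<longleftrightarrow> i = j"
        using permutes_inj[OF sigma_permutes[OF p S]] by (auto simp: \<sigma>_def dest: injD)
      ultimately show ?thesis
        using cyclic_succD(3)[OF succ, of j] cyclic_succD(3)[OF succ, of "\<sigma> j"] True
        unfolding encloses_odd encloses_even by auto
    next
      case False
      note between_iff = sigma_between_iff[OF p S nc B(1) _ _ False, folded \<sigma>_def]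
      have "\<sigma> i \<in> B" using cyclic_succD(2)[OF succ] .
      moreover have "\<sigma> j \<notin> B" unfolding \<sigma>_def using sigma_notin_block[OF p S B(1) False] .
      ultimately have "j \<noteq> \<sigma> i" "\<sigma> j \<noteq> i" "\<sigma> j \<noteq> \<sigma> i" "j \<noteq> i" using B(2) False by auto
      then show ?thesis
        using between_iff[OF B(2) \<open>\<sigma> i \<in> B\<close>] between_iff[OF \<open>\<sigma> i \<in> B\<close> B(2)]
        unfolding encloses_odd encloses_even le_less by auto
    qed
  qed
  then show ?thesis unfolding planar_def arcs_noncrossing_def \<sigma>_def by blast
qed

lemma planar_orbit_between:
  assumes "planar \<sigma>" "x < z" "z < \<sigma> x"
  shows "orbit \<sigma> z \<subseteq> {x<..<\<sigma> x}"
proof (rule orbit_closed_subset)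
  show "\<sigma> y \<in> {x<..<\<sigma> x}" if "y \<in> {x<..<\<sigma> x}" for y
    using planarD[OF assms(1), of x y] that unfolding encloses_odd encloses_even by auto
qed (use assms in simp)

lemma planar_cyclic_succ:
  assumes \<sigma>: "planar \<sigma>" "permutation \<sigma>"
  shows "cyclic_succ (orbit \<sigma> x) x (\<sigma> x)"
proof (cases "x < \<sigma> x")
  case True
  have "z \<notin> {x<..<\<sigma> x}" if z: "z \<in> orbit \<sigma> x" for z
  proof
    assume "z \<in> {x<..<\<sigma> x}"
    then have "orbit \<sigma> x \<subseteq> {x<..<\<sigma> x}"
      using planar_orbit_between[OF \<sigma>(1), of x z] orbit_eq_if_mem[OF \<sigma>(2) z] by simp
    then show False using permutation_self_in_orbit[OF \<sigma>(2), of x] by auto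
  qed
  then show ?thesis
    using True permutation_self_in_orbit[OF \<sigma>(2)] orbit.base[of \<sigma> x] unfolding cyclic_succ_def by auto
next
  case False
  have "\<sigma> y \<in> {\<sigma> x..x}" if "y \<in> {\<sigma> x..x}" for y
    using planarD[OF \<sigma>(1), of x y] that False unfolding encloses_odd encloses_even
    by (cases "y = x") auto
  then have "orbit \<sigma> x \<subseteq> {\<sigma> x..x}"
    using False by (intro orbit_closed_subset) auto
  then show ?thesis
    using False permutation_self_in_orbit[OF \<sigma>(2)] orbit.base[of \<sigma> x] unfolding cyclic_succ_def by auto
qed

lemma noncrossingI:
  assumes "\<And>B C i j k l. \<lbrakk>B \<in> p; C \<in> p; i \<in> B; k \<in> B; j \<in> C; l \<in> C; i < j; j < k; k < l\<rbrakk> \<Longrightarrow> B = C"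
  shows "noncrossing p"
  unfolding noncrossing_def
proof (intro allI impI, elim conjE bexE)
  fix i j k l B C
  assume crossing: "i < j" "j < k" "k < l" "B \<in> p" "i \<in> B" "k \<in> B" "C \<in> p" "j \<in> C" "l \<in> C"
  then have "B = C" using assms by blast
  then show "\<exists>D\<in>p. {i, j, k, l} \<subseteq> D" using crossing by blast
qed

lemma noncrossing_orbits:
  assumes \<sigma>: "planar \<sigma>" "permutation \<sigma>"
  shows "noncrossing (orbits S \<sigma>)"
proof (rule noncrossingI)
  fix B C i j k l
  assume B: "B \<in> orbits S \<sigma>" "i \<in> B" "k \<in> B" and C: "C \<in> orbits S \<sigma>" "j \<in> C" "l \<in> C"
    and less: "i < j" "j < k" "k < l"
  have orb: "orbit \<sigma> y = X" if "X \<in> orbits S \<sigma>" "y \<in> X" for X y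
    using that orbit_eq_if_mem[OF \<sigma>(2)] by (auto simp: orbits_def)
  show "B = C"
  proof (rule ccontr)
    assume "B \<noteq> C"
    then have "j \<notin> B" using orb B C by metis
    define m where "m = Max (B \<inter> {..<j})"
    have "m \<in> B \<inter> {..<j}" unfolding m_def using B(2) less(1) by (intro Max_in) auto
    then have m: "m \<in> B" "m < j" by auto
    then have succ: "cyclic_succ B m (\<sigma> m)" using planar_cyclic_succ[OF \<sigma>, of m] orb[OF B(1)] by simp
    then have "\<sigma> m \<le> k" using cyclic_succD(3)[OF succ B(3)] m less by auto
    have "j < \<sigma> m"
    proof (rule ccontr)
      assume "\<not> j < \<sigma> m"
      then have "\<sigma> m \<in> B \<inter> {..<j}"
        using cyclic_succD(2)[OF succ] \<open>j \<notin> B\<close> by (metis IntI lessThan_iff linorder_less_linear)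
      then have "\<sigma> m \<le> m" unfolding m_def by (intro Max_ge) auto
      then show False using cyclic_succD(3)[OF succ B(3)] m less by auto
    qed
    then have "C \<subseteq> {m<..<\<sigma> m}"
      using planar_orbit_between[OF \<sigma>(1) m(2)] orb[OF C(1,2)] by simp
    then show False using C(3) less \<open>\<sigma> m \<le> k\<close> by auto
  qed
qed

lemma sigma_orbits:
  assumes \<sigma>: "planar \<sigma>" "\<sigma> permutes S" and S: "finite S"
  shows "sigma (orbits S \<sigma>) = \<sigma>"
proof
  fix x
  note perm = permutes_imp_permutation[OF S \<sigma>(2)]
  note part = partition_on_orbits[OF \<sigma>(2) S]
  show "sigma (orbits S \<sigma>) x = \<sigma> x"
  proof (cases "x \<in> S")
    case True
    then show ?thesis
      using sigma_eqI[OF part S _ planar_cyclic_succ[OF \<sigma>(1) perm]] by (simp add: orbits_def)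
  next
    case False
    then show ?thesis using sigma_outside[OF part] permutes_not_in[OF \<sigma>(2)] by metis
  qed
qed

lemma NCD:
  assumes "p \<in> NC n"
  shows "partition_on {1..n} p" "noncrossing p"
  using assms by (auto simp: NC_def)

lemma orbits_in_NC:
  assumes "\<sigma> permutes {1..n}" "planar \<sigma>"
  shows "orbits {1..n} \<sigma> \<in> NC n"
  using partition_on_orbits[OF assms(1)]
    noncrossing_orbits[OF assms(2) permutes_imp_permutation[OF _ assms(1)]] by (simp add: NC_def)

lemma Lambda_eq: "Lambda n = {\<sigma>. \<sigma> permutes {1..n} \<and> planar \<sigma>}"
proof
  show "Lambda n \<subseteq> {\<sigma>. \<sigma> permutes {1..n} \<and> planar \<sigma>}"
    unfolding Lambda_def
    using sigma_permutes[OF NCD(1)] planar_sigma[OF NCD(1) finite_atLeastAtMost NCD(2)] by blast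
  show "{\<sigma>. \<sigma> permutes {1..n} \<and> planar \<sigma>} \<subseteq> Lambda n"
    using orbits_in_NC sigma_orbits unfolding Lambda_def by (auto intro!: image_eqI[OF sym])
qed

lemma Lambda_exchange:
  assumes "\<sigma> \<in> Lambda n" "\<tau> \<in> Lambda n" "\<sigma> \<noteq> \<tau>"
  obtains i k where "i \<in> {1..n}" "k \<in> {1..n}" "i \<noteq> k" "\<tau> k = \<sigma> i" "\<tau> \<circ> transposition i k \<in> Lambda n"
proof -
  have \<sigma>: "planar \<sigma>" "\<sigma> permutes {1..n}" and \<tau>: "planar \<tau>" "\<tau> permutes {1..n}"
    using assms by (auto simp: Lambda_eq)
  obtain i k where ik: "\<tau> k = \<sigma> i" "\<sigma> i \<noteq> \<tau> i" "planar (\<tau> \<circ> transposition i k)"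
    using planar_exchange[OF \<sigma>(1) permutes_bij[OF \<sigma>(2)] \<tau>(1) permutes_bij[OF \<tau>(2)] assms(3)] .
  have i: "i \<in> {1..n}" using ik(2) permutes_not_in[OF \<sigma>(2)] permutes_not_in[OF \<tau>(2)] by metis
  then have k: "k \<in> {1..n}" using permutes_in_image[OF \<sigma>(2)] permutes_in_image[OF \<tau>(2)] ik(1) by metis
  have "i \<noteq> k" using ik(1,2) by auto
  then show thesis
    using that[OF i k _ ik(1)] ik(3) permutes_comp_transposition[OF \<tau>(2) i k] by (auto simp: Lambda_eq)
qed

subsection \<open>The Hasse diagram as an induced subgraph of the Cayley graph\<close>

lemma NC_covered_merge_blocks:
  assumes p: "p \<in> NC n" and q: "merge_blocks A B p \<in> NC n" and AB: "A \<in> p" "B \<in> p" "A \<noteq> B"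
  shows "NC_covered n p (merge_blocks A B p)"
proof -
  have "p \<noteq> merge_blocks A B p"
    using Un_blocks_notin[OF NCD(1)[OF p] AB] by (auto simp: merge_blocks_def)
  then have "NC_less n p (merge_blocks A B p)"
    using refines_merge_blocks[OF NCD(1)[OF p] AB(1,2)] p q by (simp add: NC_less_def)
  then show ?thesis
    using refines_merge_blocks_cases[OF _ _ AB(1,2)] unfolding NC_covered_def NC_less_def by blast
qed

lemma sigma_comp_transposition_merge:
  assumes p: "partition_on S p" and q: "partition_on S q" and S: "finite S" and ab: "a \<in> S" "b \<in> S"
    and swap: "sigma q = sigma p \<circ> transposition a b" and orb: "orbit (sigma p) a \<noteq> orbit (sigma p) b"
  shows "q = merge_blocks (orbit (sigma p) a) (orbit (sigma p) b) p"
  using orbits_comp_transposition_merge[OF sigma_permutes[OF p S] S ab orb]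
    orbits_sigma[OF p S] orbits_sigma[OF q S]
  unfolding swap by simp

lemma orbit_sigma_in:
  assumes "partition_on S p" "finite S" "a \<in> S"
  shows "orbit (sigma p) a \<in> p"
  using orbits_sigma[OF assms(1,2)] assms(3) unfolding orbits_def by blast

lemma NC_covered_if_orbits_differ:
  assumes p: "p \<in> NC n" and q: "q \<in> NC n" and ab: "a \<in> {1..n}" "b \<in> {1..n}"
    and swap: "sigma q = sigma p \<circ> transposition a b" and orb: "orbit (sigma p) a \<noteq> orbit (sigma p) b"
  shows "NC_covered n p q"
proof -
  note orbit_in = orbit_sigma_in[OF NCD(1)[OF p] finite_atLeastAtMost]
  have "q = merge_blocks (orbit (sigma p) a) (orbit (sigma p) b) p"
    using sigma_comp_transposition_merge[OF NCD(1)[OF p] NCD(1)[OF q] finite_atLeastAtMost ab swap orb] .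
  then show ?thesis
    using NC_covered_merge_blocks[OF p _ orbit_in[OF ab(1)] orbit_in[OF ab(2)] orb] q by simp
qed

lemma transposition_imp_NC_covered:
  assumes p: "p \<in> NC n" and q: "q \<in> NC n" and ab: "a \<in> {1..n}" "b \<in> {1..n}" "a \<noteq> b"
    and swap: "sigma q = sigma p \<circ> transposition a b"
  shows "NC_covered n p q \<or> NC_covered n q p"
proof -
  have perm: "sigma p permutes {1..n}" using sigma_permutes[OF NCD(1)[OF p]] by simp
  have swap': "sigma p = sigma q \<circ> transposition a b" by (simp add: swap comp_transposition_twice)
  have "sigma q a \<noteq> sigma p a"
    using permutes_inj[OF perm] ab(3) by (auto simp: swap dest: injD)
  then have "orbits {1..n} (sigma p) \<noteq> orbits {1..n} (sigma q)"
    using orbits_sigma[OF NCD(1)[OF p]] orbits_sigma[OF NCD(1)[OF q]] by auto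
  then consider "orbit (sigma p) a \<noteq> orbit (sigma p) b" | "orbit (sigma q) a \<noteq> orbit (sigma q) b"
    using orbits_comp_transposition_same[OF permutes_imp_permutation[OF _ perm], of a b "{1..n}"]
    unfolding swap by auto
  then show ?thesis
    using NC_covered_if_orbits_differ[OF p q ab(1,2) swap]
      NC_covered_if_orbits_differ[OF q p ab(1,2) swap']
    by cases blast+
qed

text \<open>Exchange an arc of \<open>sigma q\<close> into \<open>sigma p\<close>: if its ends lay in one block of \<open>p\<close>, they would be
  consecutive in it, just as in the larger block of \<open>q\<close>.\<close>

lemma refines_NC_exchange:
  assumes p: "p \<in> NC n" and q: "q \<in> NC n" and "p \<noteq> q" and ref: "refines {1..n} p q"
  obtains i k where "i \<in> {1..n}" "k \<in> {1..n}" "sigma p \<circ> transposition i k \<in> Lambda n"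
    "orbit (sigma p) i \<noteq> orbit (sigma p) k"
    "\<exists>Y\<in>q. orbit (sigma p) i \<union> orbit (sigma p) k \<subseteq> Y"
proof -
  note part_p = NCD(1)[OF p] and part_q = NCD(1)[OF q] and fin = finite_atLeastAtMost[of 1 n]
  have "sigma p \<noteq> sigma q" using orbits_sigma[OF part_p fin] orbits_sigma[OF part_q fin] \<open>p \<noteq> q\<close> by metis
  then obtain i k where i: "i \<in> {1..n}" and k: "k \<in> {1..n}" "i \<noteq> k" "sigma p k = sigma q i"
    and in_Lambda: "sigma p \<circ> transposition i k \<in> Lambda n"
    using Lambda_exchange[of "sigma q" n "sigma p"] p q unfolding Lambda_def by (metis imageI)
  obtain A where A: "A \<in> p" "i \<in> A" using partition_on_obtain_block[OF part_p i] .
  obtain B where B: "B \<in> p" "k \<in> B" using partition_on_obtain_block[OF part_p k(1)] .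
  obtain Y where Y: "Y \<in> q" "A \<subseteq> Y" using ref A(1) unfolding refines_def by blast
  obtain Z where Z: "Z \<in> q" "B \<subseteq> Z" using ref B(1) unfolding refines_def by blast
  have succ: "cyclic_succ Y i (sigma q i)" using cyclic_succ_sigma[OF part_q fin Y(1)] A Y(2) by blast
  have end_B: "sigma q i \<in> B" using sigma_in_block[OF part_p fin B] k(3) by simp
  have "A \<noteq> B"
  proof
    assume "A = B"
    then have "sigma p i = sigma q i"
      using sigma_eqI[OF part_p fin A(1)] cyclic_succ_subset[OF succ Y(2)] A(2) end_B by blast
    then show False using permutes_inj[OF sigma_permutes[OF part_p fin]] k by (metis injD)
  qed
  moreover have "Z = Y"
    using partition_on_block_unique[OF part_q Z(1) Y(1)] end_B Z(2) cyclic_succD(2)[OF succ] by blast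
  ultimately show thesis
    using that[OF i k(1) in_Lambda] orbit_sigma[OF part_p fin A] orbit_sigma[OF part_p fin B] Y Z by auto
qed

lemma NC_covered_imp_transposition:
  assumes cov: "NC_covered n p q"
  obtains a b where "a \<in> {1..n}" "b \<in> {1..n}" "a \<noteq> b" "sigma q = sigma p \<circ> transposition a b"
proof -
  have p: "p \<in> NC n" and q: "q \<in> NC n" and "p \<noteq> q" and ref: "refines {1..n} p q"
    using cov unfolding NC_covered_def NC_less_def by blast+
  obtain i k where ik: "i \<in> {1..n}" "k \<in> {1..n}" and in_Lambda: "sigma p \<circ> transposition i k \<in> Lambda n"
    and orb: "orbit (sigma p) i \<noteq> orbit (sigma p) k" "\<exists>Y\<in>q. orbit (sigma p) i \<union> orbit (sigma p) k \<subseteq> Y"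
    using refines_NC_exchange[OF p q \<open>p \<noteq> q\<close> ref] .
  obtain r where r: "r \<in> NC n" "sigma r = sigma p \<circ> transposition i k"
    using in_Lambda unfolding Lambda_def by (metis imageE)
  note orbit_in = orbit_sigma_in[OF NCD(1)[OF p] finite_atLeastAtMost]
  have "r = merge_blocks (orbit (sigma p) i) (orbit (sigma p) k) p"
    using sigma_comp_transposition_merge[OF NCD(1)[OF p] NCD(1)[OF r(1)] finite_atLeastAtMost ik r(2)]
      orb(1) .
  then have "refines {1..n} r q"
    using merge_blocks_refines[OF ref orbit_in[OF ik(1)] orbit_in[OF ik(2)]] orb(2) by blast
  moreover have "NC_covered n p r" using NC_covered_if_orbits_differ[OF p r(1) ik r(2) orb(1)] .
  ultimately have "r = q" using cov r(1) q unfolding NC_covered_def NC_less_def by blast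
  moreover have "i \<noteq> k" using orb(1) by blast
  ultimately show thesis using that[OF ik] r(2) by simp
qed

lemma hasse_edges_eq: "hasse_edges n = cayley_edges n \<inter> Lambda n \<times> Lambda n"
proof
  have "(sigma p, sigma q) \<in> cayley_edges n \<and> (sigma q, sigma p) \<in> cayley_edges n"
    if cov: "NC_covered n p q" for p q
  proof -
    have "p \<in> NC n" "q \<in> NC n" using cov by (auto simp: NC_covered_def NC_less_def)
    then have perm: "sigma p permutes {1..n}" "sigma q permutes {1..n}"
      using sigma_permutes NCD(1) by blast+
    obtain a b where ab: "a \<in> {1..n}" "b \<in> {1..n}" "a \<noteq> b" "sigma q = sigma p \<circ> transposition a b"
      using NC_covered_imp_transposition[OF cov] .
    then have "sigma p = sigma q \<circ> transposition a b" by (simp add: comp_transposition_twice)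
    then show ?thesis using ab perm unfolding cayley_edges_def by blast
  qed
  then show "hasse_edges n \<subseteq> cayley_edges n \<inter> Lambda n \<times> Lambda n"
    unfolding hasse_edges_def Lambda_def NC_covered_def NC_less_def by blast
  show "cayley_edges n \<inter> Lambda n \<times> Lambda n \<subseteq> hasse_edges n"
    unfolding cayley_edges_def Lambda_def hasse_edges_def using transposition_imp_NC_covered by fast
qed

subsection \<open>Distances\<close>

lemma cayley_path_length_ge:
  assumes "(\<sigma>, \<tau>) \<in> cayley_edges n ^^ m" "\<sigma> permutes {1..n}"
  shows "\<tau> permutes {1..n} \<and> n \<le> num_rel_cycles {1..n} \<sigma> \<tau> + m"
  using assms
proof (induction m arbitrary: \<tau>)
  case 0
  then show ?case using num_rel_cycles_self[OF 0(2)] by simp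
next
  case (Suc m)
  then obtain \<rho> where path: "(\<sigma>, \<rho>) \<in> cayley_edges n ^^ m" and "(\<rho>, \<tau>) \<in> cayley_edges n" by auto
  then obtain a b where ab: "\<tau> = \<rho> \<circ> transposition a b" "a \<in> {1..n}" "b \<in> {1..n}"
    by (auto simp: cayley_edges_def)
  have IH: "\<rho> permutes {1..n}" "n \<le> num_rel_cycles {1..n} \<sigma> \<rho> + m"
    using Suc.IH[OF path Suc.prems(2)] by auto
  have "\<tau> permutes {1..n}"
    unfolding ab(1) using permutes_comp_transposition[OF IH(1) ab(2,3)] .
  moreover have "num_rel_cycles {1..n} \<sigma> \<rho> \<le> Suc (num_rel_cycles {1..n} \<sigma> \<tau>)"
    unfolding ab(1) using num_rel_cycles_comp_transposition_le[OF _ Suc.prems(2) IH(1) ab(2,3)] by simp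
  ultimately show ?case using IH(2) by simp
qed

lemma Lambda_path:
  assumes "\<sigma> \<in> Lambda n" "\<tau> \<in> Lambda n"
  shows "(\<sigma>, \<tau>) \<in> (cayley_edges n \<inter> Lambda n \<times> Lambda n) ^^ (n - num_rel_cycles {1..n} \<sigma> \<tau>)"
  using assms(2)
proof (induction "n - num_rel_cycles {1..n} \<sigma> \<tau>" arbitrary: \<tau> rule: less_induct)
  case (less \<tau>)
  have perm: "\<sigma> permutes {1..n}" "\<tau> permutes {1..n}" using assms(1) less.prems by (auto simp: Lambda_eq)
  show ?case
  proof (cases "\<sigma> = \<tau>")
    case True
    then show ?thesis using num_rel_cycles_self[OF perm(1)] by simp
  next
    case False
    then obtain i k where ik: "i \<in> {1..n}" "k \<in> {1..n}" "i \<noteq> k" "\<tau> k = \<sigma> i"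
      and in_Lambda: "\<tau> \<circ> transposition i k \<in> Lambda n"
      using Lambda_exchange[OF assms(1) less.prems] by blast
    define \<rho> where "\<rho> = \<tau> \<circ> transposition i k"
    have "num_rel_cycles {1..n} \<sigma> \<rho> = Suc (num_rel_cycles {1..n} \<sigma> \<tau>)"
      unfolding \<rho>_def using num_rel_cycles_comp_transposition_eq[OF _ perm ik] by simp
    moreover have "num_rel_cycles {1..n} \<sigma> \<rho> \<le> n" using num_rel_cycles_le_card[of "{1..n}"] by simp
    ultimately have dist: "n - num_rel_cycles {1..n} \<sigma> \<tau> = Suc (n - num_rel_cycles {1..n} \<sigma> \<rho>)" by simp
    have "\<rho> permutes {1..n}" "\<tau> = \<rho> \<circ> transposition i k"
      using in_Lambda by (simp_all add: \<rho>_def Lambda_eq comp_transposition_twice)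
    then have edge: "(\<rho>, \<tau>) \<in> cayley_edges n \<inter> Lambda n \<times> Lambda n"
      using ik in_Lambda less.prems unfolding cayley_edges_def \<rho>_def by blast
    have "(\<sigma>, \<rho>) \<in> (cayley_edges n \<inter> Lambda n \<times> Lambda n) ^^ (n - num_rel_cycles {1..n} \<sigma> \<rho>)"
      using less.hyps[of \<rho>] in_Lambda unfolding dist \<rho>_def by blast
    then show ?thesis
      unfolding dist using edge by (rule relpow_Suc_I)
  qed
qed

lemma relpow_mono: "E \<subseteq> F \<Longrightarrow> E ^^ m \<subseteq> F ^^ m" for E F :: "('a \<times> 'a) set"
  by (induction m) auto

lemma graph_dist_eq_num_rel_cycles:
  assumes "\<sigma> \<in> Lambda n" "\<tau> \<in> Lambda n"
    and E: "cayley_edges n \<inter> Lambda n \<times> Lambda n \<subseteq> E" "E \<subseteq> cayley_edges n"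
  shows "graph_dist E \<sigma> \<tau> = n - num_rel_cycles {1..n} \<sigma> \<tau>"
  unfolding graph_dist_def
proof (rule Least_equality)
  show "(\<sigma>, \<tau>) \<in> E ^^ (n - num_rel_cycles {1..n} \<sigma> \<tau>)"
    using Lambda_path[OF assms(1,2)] relpow_mono[OF E(1)] by (rule subsetD[rotated])
  have perm: "\<sigma> permutes {1..n}" using assms(1) by (simp add: Lambda_eq)
  show "n - num_rel_cycles {1..n} \<sigma> \<tau> \<le> m" if "(\<sigma>, \<tau>) \<in> E ^^ m" for m
    using cayley_path_length_ge[OF subsetD[OF relpow_mono[OF E(2)] that] perm] by auto
qed

lemma cayley_dist_eq:
  assumes "\<sigma> \<in> Lambda n" "\<tau> \<in> Lambda n"
  shows "cayley_dist n \<sigma> \<tau> = n - num_rel_cycles {1..n} \<sigma> \<tau>"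
  unfolding cayley_dist_def using graph_dist_eq_num_rel_cycles[OF assms] by simp

lemma Lambda_dist_eq_induced:
  "Lambda_dist n \<sigma> \<tau> = graph_dist (cayley_edges n \<inter> Lambda n \<times> Lambda n) \<sigma> \<tau>"
  unfolding Lambda_dist_def hasse_edges_eq ..

lemma Lambda_dist_eq:
  assumes "\<sigma> \<in> Lambda n" "\<tau> \<in> Lambda n"
  shows "Lambda_dist n \<sigma> \<tau> = n - num_rel_cycles {1..n} \<sigma> \<tau>"
  unfolding Lambda_dist_eq_induced using graph_dist_eq_num_rel_cycles[OF assms] by simp

subsection \<open>Drawing the arcs as semicircles\<close>

definition semicircle :: "real \<Rightarrow> real \<Rightarrow> real \<Rightarrow> complex" where
  "semicircle a b t = Complex ((1 - t) * a + t * b) (\<bar>b - a\<bar> * sqrt (t * (1 - t)))"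

lemma pathstart_semicircle: "pathstart (semicircle a b) = complex_of_real a"
  and pathfinish_semicircle: "pathfinish (semicircle a b) = complex_of_real b"
  by (simp_all add: semicircle_def pathstart_def pathfinish_def complex_of_real_def)

lemma arc_semicircle:
  assumes "a \<noteq> b"
  shows "arc (semicircle a b)"
  unfolding arc_def
proof
  show "path (semicircle a b)"
    unfolding path_def semicircle_def Complex_eq by (intro continuous_intros)
  show "inj_on (semicircle a b) {0..1}"
  proof (rule inj_onI)
    fix s t assume "semicircle a b s = semicircle a b t"
    then have "(1 - s) * a + s * b = (1 - t) * a + t * b" by (simp add: semicircle_def)
    then have "(s - t) * (b - a) = 0" by algebra
    then show "s = t" using assms by simp
  qed
qed

lemma path_image_semicircle:
  assumes "z \<in> path_image (semicircle a b)"
  shows "min a b \<le> Re z" "Re z \<le> max a b" "(Im z)\<^sup>2 = (Re z - min a b) * (max a b - Re z)"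
proof -
  obtain t where t: "0 \<le> t" "t \<le> 1" and z: "z = semicircle a b t"
    using assms by (auto simp: path_image_def)
  have Re_z: "Re z = (1 - t) * a + t * b" and Im_z: "Im z = \<bar>b - a\<bar> * sqrt (t * (1 - t))"
    by (simp_all add: z semicircle_def)
  have Re_diff: "Re z - a = t * (b - a)" "b - Re z = (1 - t) * (b - a)"
    unfolding Re_z by (simp_all add: algebra_simps)
  have "(Im z)\<^sup>2 = (Re z - a) * (b - Re z)"
    using t unfolding Im_z Re_diff power_mult_distrib power2_abs by (simp add: power2_eq_square)
  then show "(Im z)\<^sup>2 = (Re z - min a b) * (max a b - Re z)"
    by (simp add: min_def max_def algebra_simps)
  show "min a b \<le> Re z" "Re z \<le> max a b"
    using convex_bound_le[of a "max a b" b "1 - t" t] t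
      convex_bound_le[of "- a" "- min a b" "- b" "1 - t" t]
    unfolding Re_z by auto
qed

lemma path_image_semicircle_upper:
  assumes "a \<noteq> b"
  shows "path_image (semicircle a b) - {complex_of_real a, complex_of_real b} \<subseteq> {z. Im z > 0}"
proof
  fix z assume z: "z \<in> path_image (semicircle a b) - {complex_of_real a, complex_of_real b}"
  then obtain t where t: "0 \<le> t" "t \<le> 1" "z = semicircle a b t" by (auto simp: path_image_def)
  moreover have "t \<noteq> 0" "t \<noteq> 1"
    using z t(3) pathstart_semicircle[of a b] pathfinish_semicircle[of a b]
    by (auto simp: pathstart_def pathfinish_def)
  ultimately show "z \<in> {z. Im z > 0}" using assms by (simp add: semicircle_def)
qed

lemma disjoint_semicircles:
  assumes "strictly_between a b c \<longleftrightarrow> strictly_between a b d"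
    and "a \<noteq> c" "a \<noteq> d" "b \<noteq> c" "b \<noteq> d"
  shows "path_image (semicircle a b) \<inter> path_image (semicircle c d) = {}"
proof -
  have False if z: "z \<in> path_image (semicircle a b)" "z \<in> path_image (semicircle c d)" for z
  proof -
    note ab = path_image_semicircle[OF z(1)] and cd = path_image_semicircle[OF z(2)]
    have nested: "(r - m') * (M' - r) < (r - m) * (M - r)"
      if "m < m'" "m' \<le> r" "r \<le> M'" "M' < M" for m m' M M' r :: real
      using that by (intro mult_strict_mono') auto
    have "max a b < min c d \<or> max c d < min a b \<or>
      min a b < min c d \<and> max c d < max a b \<or> min c d < min a b \<and> max a b < max c d"
      using assms unfolding strictly_between_def by (smt (verit))
    then show False
      using ab cd nested[of "min a b" "min c d" "Re z" "max c d" "max a b"]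
        nested[of "min c d" "min a b" "Re z" "max a b" "max c d"] by linarith
  qed
  then show ?thesis by blast
qed

lemma strictly_between_strict_mono_on:
  assumes "strict_mono_on A f" "a \<in> A" "b \<in> A" "x \<in> A"
  shows "strictly_between (f a) (f b) (f x) \<longleftrightarrow> strictly_between a b x"
  using assms by (simp add: strictly_between_def strict_mono_on_less)

definition meander_pos :: "(nat \<Rightarrow> real) \<Rightarrow> (nat \<Rightarrow> real) \<Rightarrow> nat \<Rightarrow> real" where
  "meander_pos L R m = (if even m then L (m div 2) else R (m div 2))"

lemma meander_pos_simps [simp]: "meander_pos L R (2 * i) = L i" "meander_pos L R (Suc (2 * i)) = R i"
  by (simp_all add: meander_pos_def)

lemma strict_mono_on_meander_pos:
  assumes "meander_points n L R"
  shows "strict_mono_on {2..2 * n + 1} (meander_pos L R)"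
proof (rule strict_mono_onI)
  have step: "meander_pos L R m < meander_pos L R (Suc m)" if "2 \<le> m" "m < 2 * n + 1" for m
    using assms that by (cases "even m") (auto elim!: evenE oddE simp: meander_points_def meander_pos_def)
  fix x y :: nat
  assume "x < y" "x \<in> {2..2 * n + 1}" "y \<in> {2..2 * n + 1}"
  then show "meander_pos L R x < meander_pos L R y"
  proof (induction rule: less_Suc_induct)
    case (1 m)
    then show ?case using step by simp
  next
    case (2 x y z)
    then show ?case by force
  qed
qed

lemma meander_points_eq_iff:
  assumes points: "meander_points n L R" and xy: "x \<in> {1..n}" "y \<in> {1..n}"
  shows "L x = L y \<longleftrightarrow> x = y" "R x = R y \<longleftrightarrow> x = y" "L x \<noteq> R y"
proof -
  note eq_iff = strict_mono_on_eq[OF strict_mono_on_meander_pos[OF points]]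
  show "L x = L y \<longleftrightarrow> x = y" using eq_iff[of "2 * x" "2 * y"] xy by simp
  show "R x = R y \<longleftrightarrow> x = y" using eq_iff[of "2 * x + 1" "2 * y + 1"] xy by simp
  have "2 * x \<noteq> 2 * y + 1" by presburger
  then show "L x \<noteq> R y" using eq_iff[of "2 * x" "2 * y + 1"] xy by simp
qed

lemma planar_strictly_between_iff:
  assumes \<sigma>: "\<sigma> permutes {1..n}" "planar \<sigma>" and points: "meander_points n L R"
    and ij: "i \<in> {1..n}" "j \<in> {1..n}"
  shows "strictly_between (R i) (L (\<sigma> i)) (R j) \<longleftrightarrow> strictly_between (R i) (L (\<sigma> i)) (L (\<sigma> j))"
proof -
  note between_iff = strictly_between_strict_mono_on[OF strict_mono_on_meander_pos[OF points],
    of "2 * i + 1" "2 * \<sigma> i"]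
  have "\<sigma> i \<in> {1..n}" "\<sigma> j \<in> {1..n}" using permutes_in_image[OF \<sigma>(1)] ij by blast+
  then have "strictly_between (R i) (L (\<sigma> i)) (R j) \<longleftrightarrow> encloses \<sigma> i (2 * j + 1)"
    "strictly_between (R i) (L (\<sigma> i)) (L (\<sigma> j)) \<longleftrightarrow> encloses \<sigma> i (2 * \<sigma> j)"
    using between_iff[of "2 * j + 1"] between_iff[of "2 * \<sigma> j"] ij by (simp_all add: encloses_def)
  then show ?thesis using planarD[OF \<sigma>(2)] by simp
qed

lemma arc_family_semicircles:
  assumes \<sigma>: "\<sigma> permutes {1..n}" "planar \<sigma>" and points: "meander_points n L R"
  shows "arc_family n L R {z. Im z > 0} \<sigma> (\<lambda>i. semicircle (R i) (L (\<sigma> i)))"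
proof -
  have \<sigma>_in: "\<sigma> i \<in> {1..n}" if "i \<in> {1..n}" for i using permutes_in_image[OF \<sigma>(1)] that by blast
  have ends: "R i \<noteq> L (\<sigma> j)" if "i \<in> {1..n}" "j \<in> {1..n}" for i j
    using meander_points_eq_iff(3)[OF points \<sigma>_in[OF that(2)] that(1)] by simp
  have "path_image (semicircle (R i) (L (\<sigma> i))) \<inter> path_image (semicircle (R j) (L (\<sigma> j))) = {}"
    if ij: "i \<in> {1..n}" "j \<in> {1..n}" "i \<noteq> j" for i j
  proof (rule disjoint_semicircles)
    show "R i \<noteq> R j" using meander_points_eq_iff(2)[OF points ij(1,2)] ij(3) by simp
    show "L (\<sigma> i) \<noteq> L (\<sigma> j)"
      using meander_points_eq_iff(1)[OF points \<sigma>_in[OF ij(1)] \<sigma>_in[OF ij(2)]] permutes_inj[OF \<sigma>(1)] ij(3)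
      by (auto dest: injD)
  qed (use planar_strictly_between_iff[OF \<sigma> points ij(1,2)] ends[OF ij(1,2)] ends[OF ij(2,1)] in auto)
  then show ?thesis
    unfolding arc_family_def disjoint_family_on_def pathstart_semicircle pathfinish_semicircle
    using arc_semicircle[OF ends] path_image_semicircle_upper[OF ends] by blast
qed

lemma arc_familyD:
  assumes "arc_family n L R H \<sigma> g" "i \<in> {1..n}"
  shows "arc (g i)"
    and "pathstart (g i) = complex_of_real (R i)" "pathfinish (g i) = complex_of_real (L (\<sigma> i))"
    and "path_image (g i) - {pathstart (g i), pathfinish (g i)} \<subseteq> H"
    and "j \<in> {1..n} \<Longrightarrow> i \<noteq> j \<Longrightarrow> path_image (g i) \<inter> path_image (g j) = {}"
  using assms unfolding arc_family_def disjoint_family_on_def by blast+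

lemma arc_family_cnj:
  assumes g: "arc_family n L R H \<sigma> g"
  shows "arc_family n L R (cnj ` H) \<sigma> (\<lambda>i. cnj \<circ> g i)"
  unfolding arc_family_def disjoint_family_on_def
proof (intro conjI ballI impI)
  have inj: "inj cnj" by (rule injI) simp
  fix i assume i: "i \<in> {1..n}"
  note gi = arc_familyD[OF g i]
  show "arc (cnj \<circ> g i)" using gi(1) by (simp add: arc_linear_image_eq[OF linear_cnj inj])
  show "pathstart (cnj \<circ> g i) = complex_of_real (R i)"
    "pathfinish (cnj \<circ> g i) = complex_of_real (L (\<sigma> i))"
    using gi(2,3) by (simp_all add: pathstart_compose pathfinish_compose)
  have "path_image (cnj \<circ> g i) - {pathstart (cnj \<circ> g i), pathfinish (cnj \<circ> g i)} =
      cnj ` (path_image (g i) - {pathstart (g i), pathfinish (g i)})"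
    by (simp add: path_image_compose pathstart_compose pathfinish_compose image_set_diff[OF inj])
  then show "path_image (cnj \<circ> g i) - {pathstart (cnj \<circ> g i), pathfinish (cnj \<circ> g i)} \<subseteq> cnj ` H"
    using image_mono[OF gi(4), of cnj] by (rule ord_eq_le_trans)
  fix j assume "j \<in> {1..n}" "i \<noteq> j"
  then show "path_image (cnj \<circ> g i) \<inter> path_image (cnj \<circ> g j) = {}"
    using gi(5)[of j] by (simp add: path_image_compose flip: image_Int[OF inj])
qed

lemma cnj_upper_half_plane: "cnj ` {z. Im z > 0} = {z. Im z < 0}"
proof
  show "{z. Im z < 0} \<subseteq> cnj ` {z. Im z > 0}"
  proof
    fix z assume "z \<in> {z. Im z < 0}"
    then show "z \<in> cnj ` {z. Im z > 0}" by (intro image_eqI[of _ _ "cnj z"]) simp_all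
  qed
qed auto

lemma meander_drawing_exists:
  assumes "\<sigma> \<in> Lambda n" "\<tau> \<in> Lambda n" "meander_points n L R"
  shows "\<exists>u l. meander_drawing n L R \<sigma> \<tau> u l"
proof -
  have \<sigma>: "\<sigma> permutes {1..n}" "planar \<sigma>" and \<tau>: "\<tau> permutes {1..n}" "planar \<tau>"
    using assms(1,2) by (auto simp: Lambda_eq)
  show ?thesis
    using arc_family_semicircles[OF \<sigma> assms(3)]
      arc_family_cnj[OF arc_family_semicircles[OF \<tau> assms(3)], unfolded cnj_upper_half_plane]
    unfolding meander_drawing_def by blast
qed

subsection \<open>Closed chains of arcs and connected components\<close>

lemma arc_chain:
  assumes arcs: "\<And>k. k \<le> K \<Longrightarrow> arc (h k)"
    and link: "\<And>k. k < K \<Longrightarrow> pathfinish (h k) = pathstart (h (Suc k))"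
    and meet: "\<And>j k z. j < k \<Longrightarrow> k \<le> K \<Longrightarrow> z \<in> path_image (h j) \<Longrightarrow> z \<in> path_image (h k) \<Longrightarrow>
      k = Suc j \<and> z = pathstart (h k)"
  obtains g where "arc g" "pathstart g = pathstart (h 0)" "pathfinish g = pathfinish (h K)"
    "path_image g = (\<Union>k\<le>K. path_image (h k))"
proof -
  have "\<exists>g. arc g \<and> pathstart g = pathstart (h 0) \<and> pathfinish g = pathfinish (h m) \<and>
      path_image g = (\<Union>k\<le>m. path_image (h k))" if "m \<le> K" for m
    using that
  proof (induction m)
    case 0
    then show ?case using arcs by (intro exI[of _ "h 0"]) simp
  next
    case (Suc m)
    then obtain g where g: "arc g" "pathstart g = pathstart (h 0)" "pathfinish g = pathfinish (h m)"
      "path_image g = (\<Union>k\<le>m. path_image (h k))"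
      using Suc_leD by blast
    have joint: "pathfinish g = pathstart (h (Suc m))" using g(3) link Suc.prems by simp
    have "path_image g \<inter> path_image (h (Suc m)) \<subseteq> {pathstart (h (Suc m))}"
      using meet[of _ "Suc m"] Suc.prems unfolding g(4) by (auto simp: less_Suc_eq_le)
    then have "arc (g +++ h (Suc m))"
      using g(1) arcs[OF Suc.prems] joint by (intro arc_join)
    moreover have "path_image (g +++ h (Suc m)) = (\<Union>k\<le>Suc m. path_image (h k))"
      using path_image_join[OF joint] by (simp add: g(4) atMost_Suc Un_commute)
    ultimately show ?case using g(2) by (intro exI[of _ "g +++ h (Suc m)"]) simp
  qed
  then show thesis using that by blast
qed

lemma simple_closed_curve_chain:
  assumes arcs: "\<And>k. k \<le> Suc K \<Longrightarrow> arc (h k)"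
    and link: "\<And>k. k \<le> K \<Longrightarrow> pathfinish (h k) = pathstart (h (Suc k))"
    and closed: "pathfinish (h (Suc K)) = pathstart (h 0)"
    and meet: "\<And>j k z. j < k \<Longrightarrow> k \<le> Suc K \<Longrightarrow> z \<in> path_image (h j) \<Longrightarrow> z \<in> path_image (h k) \<Longrightarrow>
      k = Suc j \<and> z = pathstart (h k) \<or> j = 0 \<and> k = Suc K \<and> z = pathstart (h 0)"
  shows "simple_closed_curve (\<Union>k\<le>Suc K. path_image (h k))"
proof -
  obtain g where g: "arc g" "pathstart g = pathstart (h 0)" "pathfinish g = pathfinish (h K)"
    "path_image g = (\<Union>k\<le>K. path_image (h k))"
  proof (rule arc_chain[of K h])
    show "k = Suc j \<and> z = pathstart (h k)"
      if "j < k" "k \<le> K" "z \<in> path_image (h j)" "z \<in> path_image (h k)" for j k z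
      using meet[of j k z] that by auto
  qed (use arcs link in auto)
  have joint: "pathfinish g = pathstart (h (Suc K))" using g(3) link by simp
  have "path_image g \<inter> path_image (h (Suc K)) \<subseteq> {pathstart g, pathstart (h (Suc K))}"
    using meet[of _ "Suc K"] unfolding g(2,4) by (auto simp: less_Suc_eq_le)
  then have "simple_path (g +++ h (Suc K))"
    using g(1,2) arcs closed joint by (intro simple_path_join_loop) auto
  moreover have "path_image (g +++ h (Suc K)) = (\<Union>k\<le>Suc K. path_image (h k))"
    using path_image_join[OF joint] by (simp add: g(4) atMost_Suc Un_commute)
  moreover have "pathfinish (g +++ h (Suc K)) = pathstart (g +++ h (Suc K))"
    using closed g(2) by simp
  ultimately show ?thesis unfolding simple_closed_curve_def by blast
qed

lemma components_disjoint_Union: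
  fixes \<C> :: "'a::topological_space set set"
  assumes fin: "finite \<C>" and closed: "\<And>C. C \<in> \<C> \<Longrightarrow> closed C" and conn: "\<And>C. C \<in> \<C> \<Longrightarrow> connected C"
    and "{} \<notin> \<C>" and disj: "disjoint \<C>"
  shows "components (\<Union>\<C>) = \<C>"
proof -
  have component: "connected_component_set (\<Union>\<C>) x = C" if C: "C \<in> \<C>" "x \<in> C" for C x
  proof (rule connected_component_unique)
    fix K assume K: "x \<in> K" "K \<subseteq> \<Union>\<C>" "connected K"
    define D where "D = \<Union>(\<C> - {C})"
    have "closed D" unfolding D_def using fin closed by (intro closed_Union) auto
    moreover have "K \<subseteq> C \<union> D" using K(2) unfolding D_def by blast
    moreover have "C \<inter> D = {}" using disj C(1) unfolding D_def disjoint_def by blast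
    ultimately have "D \<inter> K = {}"
      using connected_closedD[OF K(3), of C D] closed[OF C(1)] C(2) K(1) by blast
    then show "K \<subseteq> C" using \<open>K \<subseteq> C \<union> D\<close> by blast
  qed (use C conn in auto)
  have "C \<in> components (\<Union>\<C>)" if "C \<in> \<C>" for C
  proof -
    obtain x where "x \<in> C" using \<open>{} \<notin> \<C>\<close> \<open>C \<in> \<C>\<close> by (metis ex_in_conv)
    then show ?thesis using component[OF \<open>C \<in> \<C>\<close>] \<open>C \<in> \<C>\<close> unfolding components_def by blast
  qed
  moreover have "components (\<Union>\<C>) \<subseteq> \<C>" using component unfolding components_def by auto
  ultimately show ?thesis by blast
qed

lemma simple_closed_curve_topology:
  assumes "simple_closed_curve C"
  shows "closed C" "connected C" "C \<noteq> {}"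
  using assms unfolding simple_closed_curve_def
  by (auto simp: simple_path_imp_path closed_path_image connected_path_image)

lemma simple_closed_curve_iff_card_components:
  assumes "\<And>C. C \<in> components X \<Longrightarrow> simple_closed_curve C"
  shows "simple_closed_curve X \<longleftrightarrow> card (components X) = 1"
proof
  assume "simple_closed_curve X"
  then have "components X = {X}"
    using simple_closed_curve_topology components_eq_sing_iff by blast
  then show "card (components X) = 1" by simp
next
  assume "card (components X) = 1"
  then obtain C where C: "components X = {C}" by (rule card_1_singletonE)
  then have "X = C" using Union_components[of X] by simp
  then show "simple_closed_curve X" using assms C by simp
qed

subsection \<open>The loops of a drawing\<close>

locale meander =
  fixes n :: nat and L R :: "nat \<Rightarrow> real" and \<sigma> \<tau> :: "nat \<Rightarrow> nat" and u l :: "nat \<Rightarrow> real \<Rightarrow> complex"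
  assumes points: "meander_points n L R" and \<sigma>: "\<sigma> permutes {1..n}" and \<tau>: "\<tau> permutes {1..n}"
    and drawing: "meander_drawing n L R \<sigma> \<tau> u l"
begin

lemma upper_arcs: "arc_family n L R {z. Im z > 0} \<sigma> u"
  and lower_arcs: "arc_family n L R {z. Im z < 0} \<tau> l"
  using drawing by (simp_all add: meander_drawing_def)

definition next_point :: "nat \<Rightarrow> nat" where
  "next_point = inv \<sigma> \<circ> \<tau>"

lemma next_point_permutes: "next_point permutes {1..n}"
  unfolding next_point_def using \<sigma> \<tau> by (rule permutes_inv_comp)

lemma permutation_next_point: "permutation next_point"
  using permutes_imp_permutation[OF _ next_point_permutes] by simp

lemma \<sigma>_eq_\<tau>_iff: "\<sigma> x = \<tau> y \<longleftrightarrow> x = next_point y"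
  unfolding next_point_def comp_apply using permutes_inv_eq[OF \<sigma>] by metis

lemma upper_lower_meet:
  assumes xy: "x \<in> {1..n}" "y \<in> {1..n}" and z: "z \<in> path_image (u x)" "z \<in> path_image (l y)"
  shows "x = y \<and> z = complex_of_real (R y) \<or> x = next_point y \<and> z = complex_of_real (L (\<sigma> x))"
proof -
  have "\<sigma> x \<in> {1..n}" "\<tau> y \<in> {1..n}" using permutes_in_image[OF \<sigma>] permutes_in_image[OF \<tau>] xy by blast+
  moreover have "z = complex_of_real (R x) \<or> z = complex_of_real (L (\<sigma> x)) \<or> Im z > 0"
    using arc_familyD(2-4)[OF upper_arcs xy(1)] z(1) by auto
  moreover have "z = complex_of_real (R y) \<or> z = complex_of_real (L (\<tau> y)) \<or> Im z < 0"
    using arc_familyD(2-4)[OF lower_arcs xy(2)] z(2) by auto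
  ultimately have "x = y \<and> z = complex_of_real (R y) \<or> \<sigma> x = \<tau> y \<and> z = complex_of_real (L (\<sigma> x))"
    using meander_points_eq_iff[OF points] xy by (auto dest: sym)
  then show ?thesis by (simp add: \<sigma>_eq_\<tau>_iff)
qed

definition loop :: "nat set \<Rightarrow> complex set" where
  "loop A = (\<Union>i\<in>A. path_image (u i) \<union> path_image (l i))"

definition nth_arc :: "nat \<Rightarrow> nat \<Rightarrow> real \<Rightarrow> complex" where
  "nth_arc x k = (if even k then l ((next_point ^^ (k div 2)) x)
     else reversepath (u ((next_point ^^ Suc (k div 2)) x)))"

lemma nth_arc_even: "nth_arc x (2 * a) = l ((next_point ^^ a) x)"
  and nth_arc_odd: "nth_arc x (Suc (2 * a)) = reversepath (u ((next_point ^^ Suc a) x))"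
  by (simp_all add: nth_arc_def)

lemma next_point_funpow_in: "x \<in> {1..n} \<Longrightarrow> (next_point ^^ k) x \<in> {1..n}"
  using permutes_in_image[OF permutes_funpow[OF next_point_permutes]] by blast

lemma arc_nth_arc:
  assumes x: "x \<in> {1..n}"
  shows "arc (nth_arc x k)"
proof (cases "even k")
  case True
  then show ?thesis
    unfolding nth_arc_def using arc_familyD(1)[OF lower_arcs next_point_funpow_in[OF x]] by presburger
next
  case False
  then show ?thesis
    unfolding nth_arc_def
    using arc_reversepath[OF arc_familyD(1)[OF upper_arcs next_point_funpow_in[OF x]]] by presburger
qed

lemma nth_arc_link:
  assumes x: "x \<in> {1..n}"
  shows "pathfinish (nth_arc x k) = pathstart (nth_arc x (Suc k))"
proof -
  note in_range = next_point_funpow_in[OF x]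
  consider (even) a where "k = 2 * a" | (odd) a where "k = Suc (2 * a)" by (metis evenE oddE Suc_eq_plus1)
  then show ?thesis
  proof cases
    case even
    have "\<sigma> ((next_point ^^ Suc a) x) = \<tau> ((next_point ^^ a) x)" by (simp add: \<sigma>_eq_\<tau>_iff)
    then show ?thesis
      unfolding even nth_arc_even nth_arc_odd pathstart_reversepath
      using arc_familyD(3)[OF upper_arcs in_range] arc_familyD(3)[OF lower_arcs in_range] by metis
  next
    case odd
    show ?thesis
      unfolding odd nth_arc_odd pathfinish_reversepath using nth_arc_even[of x "Suc a"]
        arc_familyD(2)[OF upper_arcs in_range] arc_familyD(2)[OF lower_arcs in_range]
      by (simp del: funpow.simps)
  qed
qed

context
  fixes x m :: nat
  assumes x: "x \<in> {1..n}" and period: "(next_point ^^ m) x = x"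
    and inj: "inj_on (\<lambda>k. (next_point ^^ k) x) {..<m}"
begin

lemma next_point_funpow_eq_iff: "a < m \<Longrightarrow> b < m \<Longrightarrow> (next_point ^^ a) x = (next_point ^^ b) x \<longleftrightarrow> a = b"
  using inj_on_eq_iff[OF inj] by simp

lemma next_point_funpow_Suc_eq_iff:
  "a < m \<Longrightarrow> b < m \<Longrightarrow> (next_point ^^ Suc a) x = (next_point ^^ Suc b) x \<longleftrightarrow> a = b"
  using next_point_funpow_eq_iff inj_eq[OF permutes_inj[OF next_point_permutes]] by simp

lemma nth_arc_even_disjoint:
  assumes "a < m" "b < m" "a \<noteq> b"
  shows "path_image (nth_arc x (2 * a)) \<inter> path_image (nth_arc x (2 * b)) = {}"
  unfolding nth_arc_even
  using next_point_funpow_eq_iff assms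
  by (intro arc_familyD(5)[OF lower_arcs] next_point_funpow_in x) simp

lemma nth_arc_odd_disjoint:
  assumes "a < m" "b < m" "a \<noteq> b"
  shows "path_image (nth_arc x (Suc (2 * a))) \<inter> path_image (nth_arc x (Suc (2 * b))) = {}"
  unfolding nth_arc_odd path_image_reversepath
  using next_point_funpow_Suc_eq_iff assms
  by (intro arc_familyD(5)[OF upper_arcs] next_point_funpow_in x) simp

lemma nth_arc_even_odd_meet:
  assumes ab: "a < m" "b < m"
    and z: "z \<in> path_image (nth_arc x (2 * a))" "z \<in> path_image (nth_arc x (Suc (2 * b)))"
  shows "a = b \<and> z = pathstart (nth_arc x (Suc (2 * b))) \<or>
    (a = Suc b \<or> a = 0 \<and> Suc b = m) \<and> z = pathstart (nth_arc x (2 * a))"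
proof -
  note in_range = next_point_funpow_in[OF x]
  have "z \<in> path_image (u ((next_point ^^ Suc b) x))" "z \<in> path_image (l ((next_point ^^ a) x))"
    using z unfolding nth_arc_even nth_arc_odd by simp_all
  from upper_lower_meet[OF in_range in_range this]
  consider (meet_R) "(next_point ^^ Suc b) x = (next_point ^^ a) x"
      "z = complex_of_real (R ((next_point ^^ a) x))"
    | (meet_L) "(next_point ^^ Suc b) x = (next_point ^^ Suc a) x"
      "z = complex_of_real (L (\<sigma> ((next_point ^^ Suc b) x)))"
    by (metis funpow.simps(2) comp_apply)
  then show ?thesis
  proof cases
    case meet_R
    have "z = pathstart (nth_arc x (2 * a))"
      using meet_R(2) arc_familyD(2)[OF lower_arcs in_range] unfolding nth_arc_even by simp
    moreover have "a = Suc b \<or> a = 0 \<and> Suc b = m"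
    proof (cases "Suc b = m")
      case True
      then show ?thesis using meet_R(1) period next_point_funpow_eq_iff[of 0 a] ab by simp
    next
      case False
      then show ?thesis using meet_R(1) next_point_funpow_eq_iff[of "Suc b" a] ab by simp
    qed
    ultimately show ?thesis by blast
  next
    case meet_L
    then show ?thesis
      using next_point_funpow_Suc_eq_iff[OF ab(2,1)] arc_familyD(3)[OF upper_arcs in_range]
      unfolding nth_arc_odd by (simp del: funpow.simps)
  qed
qed

lemma nth_arc_meet:
  assumes jk: "j < k" "k < 2 * m" and z: "z \<in> path_image (nth_arc x j)" "z \<in> path_image (nth_arc x k)"
  shows "k = Suc j \<and> z = pathstart (nth_arc x k) \<or> j = 0 \<and> Suc k = 2 * m \<and> z = pathstart (nth_arc x 0)"
proof -
  have parity: "(\<exists>a. i = 2 * a) \<or> (\<exists>a. i = Suc (2 * a))" for i :: nat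
    by (metis evenE oddE Suc_eq_plus1)
  consider (even_even) a b where "j = 2 * a" "k = 2 * b"
    | (odd_odd) a b where "j = Suc (2 * a)" "k = Suc (2 * b)"
    | (even_odd) a b where "j = 2 * a" "k = Suc (2 * b)"
    | (odd_even) a b where "j = Suc (2 * b)" "k = 2 * a"
    using parity[of j] parity[of k] by blast
  then show ?thesis
  proof cases
    case even_even
    then show ?thesis using nth_arc_even_disjoint[of a b] jk z by auto
  next
    case odd_odd
    then show ?thesis using nth_arc_odd_disjoint[of a b] jk z by auto
  next
    case even_odd
    then show ?thesis using nth_arc_even_odd_meet[of a b z] jk z by auto
  next
    case odd_even
    then show ?thesis using nth_arc_even_odd_meet[of a b z] jk z by auto
  qed
qed

lemma Union_nth_arc: "(\<Union>k<2 * m. path_image (nth_arc x k)) = loop ((\<lambda>k. (next_point ^^ k) x) ` {..<m})"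
proof -
  define y where "y k = (next_point ^^ k) x" for k
  have "{..<2 * m} = (\<lambda>a. 2 * a) ` {..<m} \<union> (\<lambda>a. Suc (2 * a)) ` {..<m}"
  proof (intro set_eqI iffI)
    fix k assume "k \<in> {..<2 * m}"
    then have "k = 2 * (k div 2) \<or> k = Suc (2 * (k div 2))" "k div 2 < m" by auto
    then show "k \<in> (\<lambda>a. 2 * a) ` {..<m} \<union> (\<lambda>a. Suc (2 * a)) ` {..<m}" by blast
  qed auto
  then have "(\<Union>k<2 * m. path_image (nth_arc x k)) =
      (\<Union>a<m. path_image (l (y a))) \<union> (\<Union>a<m. path_image (u (y (Suc a))))"
    by (simp only: UN_Un image_UN nth_arc_even nth_arc_odd path_image_reversepath y_def UN_simps)
  moreover have "y ` Suc ` {..<m} = y ` {..<m}"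
  proof (cases m)
    case (Suc m')
    have "insert (y 0) (y ` Suc ` {..<m}) = insert (y m) (y ` {..<m})"
      by (simp only: image_insert[symmetric] lessThan_Suc[symmetric] lessThan_Suc_eq_insert_0[symmetric])
    moreover have "y m = y 0" using period by (simp add: y_def)
    moreover have "y m \<in> y ` Suc ` {..<m}" "y 0 \<in> y ` {..<m}" using Suc by auto
    ultimately show ?thesis by (simp add: insert_absorb)
  qed simp
  then have "(\<Union>a<m. path_image (u (y (Suc a)))) = (\<Union>i\<in>y ` {..<m}. path_image (u i))"
    by (metis image_image)
  ultimately show ?thesis by (simp add: loop_def y_def UN_Un_distrib Un_commute)
qed

end

lemma simple_closed_curve_loop:
  assumes "A \<in> orbits {1..n} next_point"
  shows "simple_closed_curve (loop A)"
proof -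
  obtain x where x: "x \<in> {1..n}" and A: "A = orbit next_point x"
    using assms unfolding orbits_def by (rule imageE)
  obtain m where m: "0 < m" and period: "(next_point ^^ m) x = x"
    "inj_on (\<lambda>k. (next_point ^^ k) x) {..<m}"
    and orbit: "orbit next_point x = (\<lambda>k. (next_point ^^ k) x) ` {..<m}"
    using orbit_enumerate[OF permutation_next_point] .
  define K where "K = 2 * m - 2"
  have K: "Suc (Suc K) = 2 * m" using m by (simp add: K_def)
  have "simple_closed_curve (\<Union>k\<le>Suc K. path_image (nth_arc x k))"
  proof (rule simple_closed_curve_chain)
    show "pathfinish (nth_arc x (Suc K)) = pathstart (nth_arc x 0)"
      using nth_arc_link[OF x, of "Suc K"] period(1)
      by (simp only: K nth_arc_even) (simp add: nth_arc_def)
    show "k = Suc j \<and> z = pathstart (nth_arc x k) \<or> j = 0 \<and> k = Suc K \<and> z = pathstart (nth_arc x 0)"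
      if "j < k" "k \<le> Suc K" "z \<in> path_image (nth_arc x j)" "z \<in> path_image (nth_arc x k)" for j k z
      using nth_arc_meet[OF x period that(1) _ that(3,4)] that(2) K by auto
  qed (use arc_nth_arc[OF x] nth_arc_link[OF x] in simp_all)
  then show ?thesis
    using Union_nth_arc[OF x period] unfolding A orbit lessThan_Suc_atMost[symmetric] K by simp
qed

lemma partition_on_orbits_next_point: "partition_on {1..n} (orbits {1..n} next_point)"
  using partition_on_orbits[OF next_point_permutes] by simp

lemma disjoint_loops:
  assumes A: "A \<in> orbits {1..n} next_point" and B: "B \<in> orbits {1..n} next_point" and "A \<noteq> B"
  shows "loop A \<inter> loop B = {}"
proof (rule equals0I)
  fix z assume "z \<in> loop A \<inter> loop B"
  then obtain a b where ab: "a \<in> A" "b \<in> B"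
    and z: "z \<in> path_image (u a) \<union> path_image (l a)" "z \<in> path_image (u b) \<union> path_image (l b)"
    unfolding loop_def by (elim IntE UN_E)
  have in_range: "a \<in> {1..n}" "b \<in> {1..n}"
    using partition_on_block_subset[OF partition_on_orbits_next_point] A B ab by blast+
  have "orbit next_point a = A" "orbit next_point b = B"
    using A B ab orbit_eq_if_mem[OF permutation_next_point] unfolding orbits_def by (metis imageE)+
  then have "a \<noteq> b" "a \<noteq> next_point b" "b \<noteq> next_point a"
    using permutation_orbit_step[OF permutation_next_point] \<open>A \<noteq> B\<close> by metis+
  then show False
    using in_range z arc_familyD(5)[OF upper_arcs, of a b] arc_familyD(5)[OF lower_arcs, of a b]
      upper_lower_meet[of a b z] upper_lower_meet[of b a z] by blast
qed

lemma meander_system_eq: "meander_system n u l = \<Union>(loop ` orbits {1..n} next_point)"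
proof -
  have "\<Union>(orbits {1..n} next_point) = {1..n}"
    using partition_onD1[OF partition_on_orbits_next_point] by simp
  moreover have "loop (\<Union>\<A>) = \<Union>(loop ` \<A>)" for \<A>
    by (auto simp: loop_def)
  ultimately show ?thesis by (metis loop_def meander_system_def)
qed

lemma components_meander_system: "components (meander_system n u l) = loop ` orbits {1..n} next_point"
  unfolding meander_system_eq
proof (rule components_disjoint_Union)
  show "disjoint (loop ` orbits {1..n} next_point)"
    unfolding disjoint_def using disjoint_loops by blast
  show "closed C" "connected C" if "C \<in> loop ` orbits {1..n} next_point" for C
    using that simple_closed_curve_topology simple_closed_curve_loop by blast+
  show "{} \<notin> loop ` orbits {1..n} next_point"
    using simple_closed_curve_topology(3)[OF simple_closed_curve_loop] by (metis imageE)
qed (simp add: orbits_def)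

lemma simple_closed_curve_component:
  "C \<in> components (meander_system n u l) \<Longrightarrow> simple_closed_curve C"
  unfolding components_meander_system using simple_closed_curve_loop by blast

lemma card_components: "card (components (meander_system n u l)) = num_rel_cycles {1..n} \<sigma> \<tau>"
proof -
  have "inj_on loop (orbits {1..n} next_point)"
  proof (rule inj_onI, rule ccontr)
    fix A B
    assume AB: "A \<in> orbits {1..n} next_point" "B \<in> orbits {1..n} next_point" "A \<noteq> B" and "loop A = loop B"
    then have "loop A = {}" using disjoint_loops[OF AB] by simp
    then show False using simple_closed_curve_topology(3)[OF simple_closed_curve_loop[OF AB(1)]] by simp
  qed
  then show ?thesis
    unfolding components_meander_system by (simp add: card_image num_rel_cycles_def next_point_def)
qed

lemma simple_closed_curve_meander_system_iff:
  "simple_closed_curve (meander_system n u l) \<longleftrightarrow> num_rel_cycles {1..n} \<sigma> \<tau> = 1"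
  using simple_closed_curve_iff_card_components[OF simple_closed_curve_component]
  by (simp add: card_components)

end

theorem theorem3p2:
  fixes n :: nat and \<sigma> \<tau> :: "nat \<Rightarrow> nat" and L R :: "nat \<Rightarrow> real"
  assumes "n \<ge> 1"
    and "\<sigma> \<in> Lambda n" and "\<tau> \<in> Lambda n"
    and "meander_points n L R"
  shows "Lambda_dist n \<sigma> \<tau> = graph_dist (cayley_edges n \<inter> Lambda n \<times> Lambda n) \<sigma> \<tau> \<and>
    (\<exists>u l. meander_drawing n L R \<sigma> \<tau> u l) \<and>
    (\<forall>u l. meander_drawing n L R \<sigma> \<tau> u l \<longrightarrow>
       (\<forall>C\<in>components (meander_system n u l). simple_closed_curve C) \<and>
       (\<forall>k::int.
          (int (card (components (meander_system n u l))) = k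
             \<longleftrightarrow> int (cayley_dist n \<sigma> \<tau>) = int n - k) \<and>
          (int (cayley_dist n \<sigma> \<tau>) = int n - k
             \<longleftrightarrow> int (Lambda_dist n \<sigma> \<tau>) = int n - k)) \<and>
       (simple_closed_curve (meander_system n u l)
          \<longleftrightarrow> cayley_dist n \<sigma> \<tau> = n - 1 \<and> Lambda_dist n \<sigma> \<tau> = n - 1))"
proof -
  let ?c = "num_rel_cycles {1..n} \<sigma> \<tau>"
  note dist = cayley_dist_eq[OF assms(2,3)] Lambda_dist_eq[OF assms(2,3)]
  have "?c \<le> n" using num_rel_cycles_le_card[of "{1..n}"] by simp
  then have c_iff: "int (n - ?c) = int n - k \<longleftrightarrow> int ?c = k" "n - ?c = n - 1 \<longleftrightarrow> ?c = 1" for k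
    using assms(1) by auto
  have "(\<forall>C\<in>components (meander_system n u l). simple_closed_curve C) \<and>
      card (components (meander_system n u l)) = ?c \<and>
      (simple_closed_curve (meander_system n u l) \<longleftrightarrow> ?c = 1)"
    if "meander_drawing n L R \<sigma> \<tau> u l" for u l
  proof -
    interpret meander n L R \<sigma> \<tau> u l
      using assms that by unfold_locales (simp_all add: Lambda_eq)
    show ?thesis
      using simple_closed_curve_component card_components simple_closed_curve_meander_system_iff by blast
  qed
  then show ?thesis
    using meander_drawing_exists[OF assms(2-4)]
    unfolding Lambda_dist_eq_induced[symmetric] dist c_iff by simp
qed

end
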